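(* Let $n>1$ and $0\leq c\leq n-2$ be integers. Denote by $t$ the residue of $n$ modulo $n-c$ (so $0\le t<n-c$), and set $s=\lfloor n/(n-c) \rfloor$. For every connected graph $H$ with $n$ vertices and exactly $c$ cut vertices, we have $$\mathrm{N}(H)\leq (n-c-t)\binom{s}{2}+t\binom{s+1}{2}+(s+1)^{n-c-t}(s+2)^t -1 .$$ Equality holds if and only if $H$ is isomorphic to the graph $G(s;\ldots;s; s+1;\ldots; s+1)$ ($n-c-t$ copies of $s$ followed by $t$ copies of $s+1$).
   Context: All graphs are finite and simple. A cut vertex of a graph $G$ is a vertex $u$ such that $G-u$ (delete $u$ and all incident edges) has more connected components than $G$. An induced subgraph of $G$ is always taken with nonempty vertex set, and distinct vertex subsets give distinct induced subgraphs; $\mathrm{N}(G)$ denotes the number of connected induced subgraphs of $G$, i.e. the number of nonempty subsets of $V(G)$ inducing a connected graph. $P_m$ is the path on $m$ vertices ($P_1$ is a single vertex, which is regarded as its own leaf), and $K_q$ is the complete graph on $q$ vertices. For integers $q\ge 2$ and $n_1,\ldots,n_q\ge 1$, the graph $G(n_1;\ldots;n_q)$ is constructed as follows: take pairwise vertex disjoint graphs $K_q,P_{n_1},\ldots,P_{n_q}$ with $V(K_q)=\{v_1,\ldots,v_q\}$; for every $j\in\{1,\ldots,q\}$ let $u_j$ be a leaf of $P_{n_j}$ and identify $u_j$ with $v_j$. *)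

theory Defs
  imports "Graph_Theory.Graph_Theory"
begin

definition components :: "('a, 'b) pre_digraph \<Rightarrow> ('a, 'b) pre_digraph set" where
  "components G = {C. pre_digraph.max_subgraph G connected C}"

definition cut_vertex :: "('a, 'b) pre_digraph \<Rightarrow> 'a \<Rightarrow> bool" where
  "cut_vertex G u \<longleftrightarrow> u \<in> verts G \<and>
     card (components (pre_digraph.del_vert G u)) > card (components G)"

definition num_conn_induced :: "('a, 'b) pre_digraph \<Rightarrow> nat" where
  "num_conn_induced G = card {S. S \<subseteq> verts G \<and> S \<noteq> {} \<and> connected (G \<restriction> S)}"

(* The graph G(n_1; ...; n_q), where ns = [n_1, ..., n_q] consists of positive numbers:
   (j, 0), (j, 1), ..., (j, ns ! j - 1) are the consecutive vertices of the j-th path (j < q),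
   and its leaf (j, 0) is also the j-th vertex of the clique K_q. *)
definition clique_paths :: "nat list \<Rightarrow> (nat \<times> nat) pair_pre_digraph" where
  "clique_paths ns = \<lparr>
     pverts = (SIGMA j : {..<length ns}. {..<ns ! j}),
     parcs = {((j, 0), (k, 0)) | j k. j < length ns \<and> k < length ns \<and> j \<noteq> k}
       \<union> {((j, i), (j, i')) | j i i'. j < length ns \<and> i < ns ! j \<and> i' < ns ! j \<and>
            (i' = Suc i \<or> i = Suc i')}\<rparr>"

lemma pair_graph_clique_paths:
  assumes "\<forall>m \<in> set ns. m \<ge> 1"
  shows "pair_graph (clique_paths ns)"
proof -
  have pos: "ns ! j > 0" if "j < length ns" for j
    using assms that by (metis One_nat_def Suc_le_eq nth_mem)
  let ?V = "pverts (clique_paths ns)" and ?A = "parcs (clique_paths ns)"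
  have sub: "?A \<subseteq> ?V \<times> ?V"
    using pos by (auto simp: clique_paths_def)
  have fin: "finite ?V"
    by (simp add: clique_paths_def)
  have symA: "sym ?A"
    by (auto simp: clique_paths_def sym_def)
  have irr: "fst e \<noteq> snd e" if "e \<in> ?A" for e
    using that by (auto simp: clique_paths_def)
  show ?thesis
    by unfold_locales (use sub fin symA irr in \<open>auto simp: symmetric_def intro: finite_subset\<close>)
qed

end

theory Submission
  imports Defs "HOL-Library.Multiset"
begin

text \<open>
Write \<open>k = n - c\<close> for the number of non-cut vertices of \<open>H\<close>; the hypotheses say \<open>k \<ge> 2\<close>.

Fix a non-cut vertex \<open>r\<close> and let the parent of any other vertex \<open>v\<close> be the last vertex that all
paths from \<open>r\<close> to \<open>v\<close> have in common before \<open>v\<close>. This makes the vertices of \<open>H\<close> a rooted tree; its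
inner vertices other than \<open>r\<close> are the cut vertices, so it has \<open>k - 1\<close> leaves. A connected set cannot
jump over a vertex that separates two of its elements. Hence it is a \<^emph>\<open>region\<close> of the tree: a
nonempty set whose topmost vertices are siblings (or just the root) and which contains, with each of
its other elements, the parent of that element (lemma tree_cover_exists, by grafting trees along cut
vertices). So \<open>H\<close> has at most as many connected sets as the tree has regions, and that number is
computed recursively along the tree.

It remains to maximise the number of regions over trees with \<open>n\<close> vertices and \<open>k - 1\<close> leaves. If
\<open>v\<close> is the topmost branching vertex and \<open>u\<close> is the next one on some path down from \<open>v\<close>, then either hanging all other
branches of \<open>v\<close> on \<open>u\<close>, or hanging all branches of \<open>u\<close> but one on \<open>v\<close>, creates strictly more regions
(merge_forks). So only brooms need be considered: a path from the root down to a vertex that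
carries \<open>k - 1\<close> paths. With \<open>n\<^sub>1, \<dots>, n\<^sub>k\<close> vertices on these \<open>k\<close> paths, a broom has
\<open>\<Sum> (n\<^sub>i choose 2) + \<Prod> (n\<^sub>i + 1) - 1\<close> regions. Moving a vertex from a long path to a path shorter by at
least two does not decrease this number, and increases it if \<open>k \<ge> 3\<close>
(clique_paths_count_smooth), so equal lengths up to one are best. For \<open>k = 2\<close> the broom is a single
path, which may be cut in two at any place.

If equality holds, the tree is a broom with balanced paths (after a new cut if \<open>k = 2\<close>) and \<^emph>\<open>every\<close>
region is connected. The two-element regions show that consecutive vertices on a path, and the ends of any
two paths at the hub, are adjacent. So \<open>H\<close> contains \<open>G(n\<^sub>1; \<dots>; n\<^sub>k)\<close> as a spanning subgraph. That
graph has at least the extremal number of connected sets (num_conn_clique_paths_ge), and one more edge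
would add one more connected set, so \<open>H\<close> is that graph. The same lower bound, together with the
upper bound for \<open>H\<close>, gives the converse direction.
\<close>

section \<open>Connected vertex sets\<close>

text \<open>
The induced subgraph on a vertex set is studied through the adjacency relation of the whole graph, so
that passing to a subset of the vertices does not change the graph.
\<close>

definition conn :: "'a rel \<Rightarrow> 'a set \<Rightarrow> bool" where
  "conn E S \<longleftrightarrow> S \<noteq> {} \<and> (\<forall>x\<in>S. \<forall>y\<in>S. (x, y) \<in> (Restr E S)\<^sup>*)"

lemma conn_nonempty: "conn E S \<Longrightarrow> S \<noteq> {}"
  by (simp add: conn_def)

lemma connD: "conn E S \<Longrightarrow> x \<in> S \<Longrightarrow> y \<in> S \<Longrightarrow> (x, y) \<in> (Restr E S)\<^sup>*"
  by (simp add: conn_def)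

lemma rtrancl_Restr_in: "(x, y) \<in> (Restr E S)\<^sup>* \<Longrightarrow> x \<in> S \<Longrightarrow> y \<in> S"
  by (induction rule: rtrancl_induct) auto

lemma rtrancl_Restr_mono: "(x, y) \<in> (Restr E S)\<^sup>* \<Longrightarrow> E \<subseteq> F \<Longrightarrow> S \<subseteq> T \<Longrightarrow> (x, y) \<in> (Restr F T)\<^sup>*"
  using rtrancl_mono[of "Restr E S" "Restr F T"] by blast

lemma sym_rtrancl_Restr: "sym E \<Longrightarrow> sym ((Restr E S)\<^sup>*)"
  by (intro sym_rtrancl) (auto simp: sym_def)

lemma conn_fromI:
  assumes "sym E" "x \<in> S" "\<And>y. y \<in> S \<Longrightarrow> (x, y) \<in> (Restr E S)\<^sup>*"
  shows "conn E S"
  unfolding conn_def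
proof (intro conjI ballI)
  fix y z assume "y \<in> S" "z \<in> S"
  then have "(y, x) \<in> (Restr E S)\<^sup>*" "(x, z) \<in> (Restr E S)\<^sup>*"
    using assms(3) sym_rtrancl_Restr[OF assms(1)] by (auto dest: symD)
  then show "(y, z) \<in> (Restr E S)\<^sup>*" by (rule rtrancl_trans)
qed (use assms(2) in auto)

lemma conn_pair: "sym E \<Longrightarrow> (x, y) \<in> E \<Longrightarrow> conn E {x, y}"
  by (intro conn_fromI[of _ x]) auto

lemma conn_pairD:
  assumes "conn E {x, y}" "x \<noteq> y"
  shows "(x, y) \<in> E"
proof -
  have "(x, y) \<in> (Restr E {x, y})\<^sup>*" using assms(1) by (auto simp: conn_def)
  then have "y = x \<or> (x, y) \<in> E"
    by (induction rule: rtrancl_induct) auto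
  then show ?thesis using assms(2) by simp
qed

lemma conn_Un:
  assumes "sym E" "conn E S" "conn E T" "S \<inter> T \<noteq> {}"
  shows "conn E (S \<union> T)"
proof -
  obtain x where x: "x \<in> S" "x \<in> T" using assms(4) by auto
  show ?thesis
  proof (rule conn_fromI[OF assms(1), of x])
    fix y assume "y \<in> S \<union> T"
    then have "(x, y) \<in> (Restr E S)\<^sup>* \<or> (x, y) \<in> (Restr E T)\<^sup>*"
      using assms(2,3) x by (auto dest: connD)
    then show "(x, y) \<in> (Restr E (S \<union> T))\<^sup>*"
      by (auto elim: rtrancl_Restr_mono)
  qed (use x in auto)
qed

lemma conn_image:
  assumes "conn E S" "\<And>x y. x \<in> S \<Longrightarrow> y \<in> S \<Longrightarrow> (x, y) \<in> E \<Longrightarrow> (f x, f y) \<in> F"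
  shows "conn F (f ` S)"
  unfolding conn_def
proof (intro conjI ballI)
  have *: "(f x, f y) \<in> (Restr F (f ` S))\<^sup>*" if "(x, y) \<in> (Restr E S)\<^sup>*" for x y
    using that
  proof (induction rule: rtrancl_induct)
    case (step y z)
    then have "(f y, f z) \<in> Restr F (f ` S)" using assms(2) by auto
    with step.IH show ?case by (rule rtrancl_into_rtrancl)
  qed simp
  fix u v assume "u \<in> f ` S" "v \<in> f ` S"
  then show "(u, v) \<in> (Restr F (f ` S))\<^sup>*" using * connD[OF assms(1)] by auto
qed (use conn_nonempty[OF assms(1)] in auto)

text \<open>
A walk inside \<open>S\<close> can change sides only at \<open>x\<close>. If \<open>x \<notin> S\<close>, it never does. If \<open>x \<in> S\<close>, a walk from \<open>x\<close> to a
vertex of one side runs inside that side from its last visit of \<open>x\<close> on.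
\<close>

lemma conn_split:
  assumes E: "sym E" and PQ: "P \<inter> Q = {x}"
    and sep: "\<And>y z. y \<in> P - {x} \<Longrightarrow> z \<in> Q - {x} \<Longrightarrow> (y, z) \<notin> E"
    and S: "conn E S" "S \<subseteq> P \<union> Q"
  shows "S \<subseteq> P - {x} \<or> S \<subseteq> Q - {x} \<or> x \<in> S \<and> conn E (S \<inter> P) \<and> conn E (S \<inter> Q)"
proof (cases "x \<in> S")
  case True
  have *: "conn E (S \<inter> A)"
    if AB: "A \<inter> B = {x}" "S \<subseteq> A \<union> B" "\<And>y z. y \<in> A - {x} \<Longrightarrow> z \<in> B - {x} \<Longrightarrow> (z, y) \<notin> E" for A B
  proof (rule conn_fromI[OF E, of x])
    show "x \<in> S \<inter> A" using True AB(1) by auto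
    have "y \<in> A \<longrightarrow> (x, y) \<in> (Restr E (S \<inter> A))\<^sup>*" if "(x, y) \<in> (Restr E S)\<^sup>*" for y
      using that
    proof (induction rule: rtrancl_induct)
      case (step y z)
      show ?case
      proof (intro impI, cases "z = x")
        case False
        assume "z \<in> A"
        then have "y \<in> A" using AB False step.hyps(2) by blast
        then have "(y, z) \<in> Restr E (S \<inter> A)" using step.hyps(2) \<open>z \<in> A\<close> by auto
        then show "(x, z) \<in> (Restr E (S \<inter> A))\<^sup>*"
          using step.IH \<open>y \<in> A\<close> by (meson rtrancl.rtrancl_into_rtrancl)
      qed simp
    qed simp
    then show "(x, y) \<in> (Restr E (S \<inter> A))\<^sup>*" if "y \<in> S \<inter> A" for y
      using that connD[OF S(1) True] by auto
  qed
  have "conn E (S \<inter> P)" using PQ S(2) sep E by (intro *[of P Q]) (auto dest: symD)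
  moreover have "conn E (S \<inter> Q)" using PQ S(2) sep by (intro *[of Q P]) auto
  ultimately show ?thesis using True by blast
next
  case False
  show ?thesis
  proof (rule ccontr)
    assume n: "\<not> ?thesis"
    then obtain y where y: "y \<in> S" "y \<in> P - {x}" using S(2) False by blast
    have "z \<in> P - {x}" if "(y, z) \<in> (Restr E S)\<^sup>*" for z
      using that
    proof (induction rule: rtrancl_induct)
      case (step z w)
      then show ?case using sep[of z w] S(2) False PQ by auto
    qed (use y in auto)
    then have "S \<subseteq> P - {x}" using connD[OF S(1) y(1)] by blast
    then show False using n by blast
  qed
qed

section \<open>Components and cut vertices\<close>

lemma rtrancl_on_iff: "x \<in> S \<Longrightarrow> (x, y) \<in> rtrancl_on S E \<longleftrightarrow> (x, y) \<in> (Restr E S)\<^sup>*"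
proof
  show "(x, y) \<in> rtrancl_on S E \<Longrightarrow> (x, y) \<in> (Restr E S)\<^sup>*"
    by (induction rule: rtrancl_on_induct) (auto intro: rtrancl_into_rtrancl)
  show "(x, y) \<in> (Restr E S)\<^sup>* \<Longrightarrow> (x, y) \<in> rtrancl_on S E" if "x \<in> S"
  proof (induction rule: rtrancl_induct)
    case base then show ?case using that by auto
  next
    case (step y z)
    then show ?case by (auto intro: rtrancl_on_into_rtrancl_on)
  qed
qed

lemma strongly_connected_iff_conn:
  "strongly_connected G \<longleftrightarrow> conn (arcs_ends G) (verts G)"
  by (auto simp: strongly_connected_def conn_def reachable_def rtrancl_on_iff)

lemma connected_induced_iff_conn:
  assumes "pair_graph H"
  shows "connected (with_proj H \<restriction> S) \<longleftrightarrow> conn (parcs H) S"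
proof -
  interpret pair_graph H by fact
  have "parcs (mk_symmetric (with_proj H \<restriction> S)) = Restr (parcs H) S"
    by (auto simp: parcs_mk_symmetric dest: arcs_symmetric)
  then show ?thesis
    by (simp add: connected_def strongly_connected_iff_conn) (simp add: conn_def Int_assoc)
qed

lemma connected_iff_conn:
  assumes "pair_graph H"
  shows "connected (with_proj H) \<longleftrightarrow> conn (parcs H) (pverts H)"
proof -
  interpret pair_graph H by fact
  have "with_proj H \<restriction> pverts H = with_proj H"
    by (auto simp: induce_subgraph_def with_proj_def dest: wellformed')
  then show ?thesis using connected_induced_iff_conn[OF assms, of "pverts H"] by simp
qed

lemma components_connected:
  fixes G :: "('a, 'b) pre_digraph"
  assumes "wf_digraph G" "connected G"
  shows "components G = {G}"
proof -
  have anti: "K = L" if "subgraph K L" "subgraph L K" for K L :: "('a, 'b) pre_digraph"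
    using that by (auto simp: subgraph_def compatible_def)
  have refl: "subgraph G G" using wf_digraph.subgraph_refl[OF assms(1)] .
  show ?thesis
    unfolding components_def pre_digraph.max_subgraph_def
  proof (intro equalityI subsetI)
    fix C assume "C \<in> {C. subgraph C G \<and> connected C \<and>
      (\<forall>H'. H' \<noteq> C \<and> subgraph C H' \<longrightarrow> \<not> (subgraph H' G \<and> connected H'))}"
    then have C: "subgraph C G" "\<forall>H'. H' \<noteq> C \<and> subgraph C H' \<longrightarrow> \<not> (subgraph H' G \<and> connected H')"
      by auto
    show "C \<in> {G}" using C(2)[rule_format, of G] C(1) refl assms(2) by auto
  qed (use anti refl assms(2) in blast)
qed

lemma finite_subgraphs:
  assumes "finite (verts G)" "finite (arcs G)"
  shows "finite {C. subgraph C G}"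
proof -
  let ?f = "\<lambda>C. (verts C, arcs C)"
  have "?f ` {C. subgraph C G} \<subseteq> Pow (verts G) \<times> Pow (arcs G)"
    by (auto simp: subgraph_def)
  moreover have "inj_on ?f {C. subgraph C G}"
    by (auto simp: inj_on_def subgraph_def compatible_def)
  ultimately show ?thesis
    using assms by (meson finite_Pow_iff finite_SigmaI finite_imageD finite_subset)
qed

text \<open>
The vertices reachable from a given vertex induce a component; two vertices that cannot reach each
other give two of them.
\<close>

lemma components_not_connected:
  assumes "pair_graph H" "pverts H \<noteq> {}" "\<not> conn (parcs H) (pverts H)"
  shows "card (components (with_proj H)) \<ge> 2"
proof -
  interpret pair_graph H by fact
  let ?E = "parcs H"
  have sE: "sym ?E" using sym_arcs by (simp add: symmetric_def)
  have wf: "Restr ?E (pverts H) = ?E" by (auto dest: wellformed')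
  define R where "R x = {y. (x, y) \<in> ?E\<^sup>*}" for x
  have R_sub: "R x \<subseteq> pverts H" if "x \<in> pverts H" for x
    using that rtrancl_Restr_in[of x _ ?E "pverts H"] by (auto simp: R_def wf)
  have max: "with_proj H \<restriction> R x \<in> components (with_proj H)" if x: "x \<in> pverts H" for x
  proof -
    have stay: "(x, y) \<in> (Restr ?E (R x))\<^sup>*" if "(x, y) \<in> ?E\<^sup>*" for y
      using that
    proof (induction rule: rtrancl_induct)
      case (step y z)
      then have "(y, z) \<in> Restr ?E (R x)" by (auto simp: R_def)
      with step.IH show ?case by (rule rtrancl_into_rtrancl)
    qed simp
    have "conn ?E (R x)"
      by (rule conn_fromI[OF sE, of x]) (use stay in \<open>auto simp: R_def\<close>)
    then have c: "connected (with_proj H \<restriction> R x)"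
      using connected_induced_iff_conn[OF assms(1)] by simp
    have s: "subgraph (with_proj H \<restriction> R x) (with_proj H)"
      using induced_imp_subgraph induced_induce R_sub[OF x] by auto
    have "K = with_proj H \<restriction> R x"
      if K: "subgraph (with_proj H \<restriction> R x) K" "subgraph K (with_proj H)" "connected K" for K
    proof -
      have ht: "tail K = fst" "head K = snd" using K(2) by (auto simp: subgraph_def compatible_def)
      have arcsK: "arcs K \<subseteq> ?E" and wfK: "wf_digraph K" using K(2) by (auto simp: subgraph_def)
      have "R x \<subseteq> verts K" using K(1) by (auto simp: subgraph_def)
      then have "x \<in> verts K" by (auto simp: R_def)
      have "parcs (mk_symmetric K) \<subseteq> ?E"
        using arcsK sE by (auto simp: parcs_mk_symmetric ht dest: symD)
      then have "verts K \<subseteq> R x"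
        using K(3) \<open>x \<in> verts K\<close> rtrancl_mono[of "Restr (parcs (mk_symmetric K)) (verts K)" ?E]
        by (fastforce simp: connected_def strongly_connected_iff_conn R_def conn_def)
      with \<open>R x \<subseteq> verts K\<close> have vK: "verts K = R x" by simp
      have "arcs K = arcs (with_proj H \<restriction> R x)"
      proof
        show "arcs K \<subseteq> arcs (with_proj H \<restriction> R x)"
          using arcsK wf_digraph.wellformed[OF wfK] by (auto simp: ht vK)
        show "arcs (with_proj H \<restriction> R x) \<subseteq> arcs K" using K(1) by (auto simp: subgraph_def)
      qed
      then show ?thesis using vK ht by (intro pre_digraph.equality) auto
    qed
    then show ?thesis using s c by (auto simp: components_def max_subgraph_def)
  qed
  obtain x y where xy: "x \<in> pverts H" "y \<in> pverts H" "(x, y) \<notin> ?E\<^sup>*"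
    using assms(2,3) by (auto simp: conn_def wf)
  have "y \<in> R y" "y \<notin> R x" using xy by (auto simp: R_def)
  then have "verts (with_proj H \<restriction> R x) \<noteq> verts (with_proj H \<restriction> R y)" by auto
  then have "with_proj H \<restriction> R x \<noteq> with_proj H \<restriction> R y" by metis
  then have "2 \<le> card {with_proj H \<restriction> R x, with_proj H \<restriction> R y}" by simp
  also have "\<dots> \<le> card (components (with_proj H))"
  proof (rule card_mono)
    have "components (with_proj H) \<subseteq> {C. subgraph C (with_proj H)}"
      by (auto simp: components_def max_subgraph_def)
    then show "finite (components (with_proj H))"
      using finite_subgraphs[of "with_proj H"] pair_finite_verts pair_finite_arcs
      by (auto intro: finite_subset)
  qed (use max xy in auto)
  finally show ?thesis .
qed

text \<open>
A connected graph has one component, so the comparison of component counts in the definition of a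
cut vertex reduces to connectedness after deletion. With at least two vertices, the deletion leaves
something behind, and the number of its components is at least one.
\<close>

lemma cut_vertex_iff_conn:
  assumes H: "pair_graph H" "connected (with_proj H)" "card (pverts H) > 1"
  shows "cut_vertex (with_proj H) u \<longleftrightarrow> u \<in> pverts H \<and> \<not> conn (parcs H) (pverts H - {u})"
proof (cases "u \<in> pverts H")
  case True
  interpret pair_graph H by fact
  define K where "K = \<lparr> pverts = pverts H - {u}, parcs = Restr (parcs H) (- {u}) \<rparr>"
  have dv: "del_vert u = with_proj K"
    by (auto simp: pre_digraph.del_vert_def with_proj_def K_def)
  have K: "pair_graph K"
    by unfold_locales
      (use pair_no_loops pair_finite_verts pair_finite_arcs in
        \<open>auto simp: K_def symmetric_def sym_def dest: wellformed' arcs_symmetric\<close>)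
  have "\<not> pverts H \<subseteq> {u}" using H(3) card_mono[of "{u}" "pverts H"] by auto
  then have ne: "pverts K \<noteq> {}" by (auto simp: K_def)
  have cK: "conn (parcs K) (pverts K) \<longleftrightarrow> conn (parcs H) (pverts H - {u})"
  proof -
    have "pverts K = pverts H - {u}" "Restr (parcs K) (pverts K) = Restr (parcs H) (pverts H - {u})"
      by (auto simp: K_def)
    then show ?thesis by (simp add: conn_def)
  qed
  have c1: "card (components (with_proj H)) = 1"
    using components_connected[OF _ H(2)] by (simp add: wf_digraph_wp_iff pair_wf_digraph)
  have "card (components (with_proj K)) > 1 \<longleftrightarrow> \<not> conn (parcs K) (pverts K)"
  proof (cases "conn (parcs K) (pverts K)")
    case True
    then show ?thesis using components_connected[of "with_proj K"] K connected_iff_conn[OF K]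
      by (simp add: wf_digraph_wp_iff pair_graph_def pair_digraph_def pair_fin_digraph_def)
  next
    case False
    then show ?thesis using components_not_connected[OF K ne] by simp
  qed
  then show ?thesis using True cK c1 dv by (simp add: cut_vertex_def)
qed (simp add: cut_vertex_def)

section \<open>Rooted trees and their regions\<close>

datatype 'a rtree = Node 'a "'a rtree list"

fun labels :: "'a rtree \<Rightarrow> 'a multiset" where
  "labels (Node x ts) = add_mset x (\<Sum>t\<leftarrow>ts. labels t)"

fun leaves :: "'a rtree \<Rightarrow> 'a multiset" where
  "leaves (Node x ts) = (if ts = [] then {#x#} else (\<Sum>t\<leftarrow>ts. leaves t))"

text \<open>
The numbers \<open>num_top\<close> and \<open>num_deep\<close> bound the numbers of regions that contain the root
and that avoid it: a region through the root chooses, independently for each child, either nothing or a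
region through that child.
\<close>

fun num_top :: "'a rtree \<Rightarrow> nat" where
  "num_top (Node x ts) = (\<Prod>t\<leftarrow>ts. Suc (num_top t))"

fun num_deep :: "'a rtree \<Rightarrow> nat" where
  "num_deep (Node x ts) = (\<Prod>t\<leftarrow>ts. Suc (num_top t)) - 1 + (\<Sum>t\<leftarrow>ts. num_deep t)"

text \<open>
What the children of a vertex contribute to a region, when each child independently offers the
regions through itself or stays out.
\<close>

fun joins :: "'a set set list \<Rightarrow> 'a set set" where
  "joins [] = {{}}"
| "joins (F # Fs) = {X \<union> Y | X Y. X \<in> insert {} F \<and> Y \<in> joins Fs}"

text \<open>
Regions through the root. Regions that avoid the root are in \<open>deep_regions\<close>: their topmost
vertices are either some children of the root or lie in the subtree of a single child.
\<close>

fun top_regions :: "'a rtree \<Rightarrow> 'a set set" where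
  "top_regions (Node x ts) = insert x ` joins (map top_regions ts)"

fun deep_regions :: "'a rtree \<Rightarrow> 'a set set" where
  "deep_regions (Node x ts) = (joins (map top_regions ts) - {{}}) \<union> (\<Union>t\<in>set ts. deep_regions t)"

lemma empty_in_joins [simp]: "{} \<in> joins Fs"
  by (induction Fs) auto

lemma joins_ConsI: "X \<in> insert {} F \<Longrightarrow> Y \<in> joins Fs \<Longrightarrow> X \<union> Y \<in> joins (F # Fs)"
  by auto

lemma joins_ConsE:
  assumes "S \<in> joins (F # Fs)"
  obtains X Y where "S = X \<union> Y" "X \<in> insert {} F" "Y \<in> joins Fs"
  using assms by auto

lemma joins_appendI: "X \<in> joins Fs \<Longrightarrow> Y \<in> joins Gs \<Longrightarrow> X \<union> Y \<in> joins (Fs @ Gs)"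
proof (induction Fs arbitrary: X)
  case (Cons F Fs)
  from Cons.prems(1) obtain X' Z where X: "X = X' \<union> Z" "X' \<in> insert {} F" "Z \<in> joins Fs"
    by (rule joins_ConsE)
  have "X' \<union> (Z \<union> Y) \<in> joins (F # (Fs @ Gs))"
    using X(2) Cons.IH[OF X(3) Cons.prems(2)] by (rule joins_ConsI)
  then show ?case by (simp only: X(1) Un_assoc append_Cons)
qed simp

text \<open>
Transport of choices along a map of sets that commutes with unions; used with the map that extends a
set through a grafted vertex.
\<close>

lemma joins_map:
  assumes "S \<in> joins (map f ts)" "g {} = {}" "\<And>X Y. g (X \<union> Y) = g X \<union> g Y"
    "\<And>t X. t \<in> set ts \<Longrightarrow> X \<in> f t \<Longrightarrow> g X \<in> f' t"
  shows "g S \<in> joins (map f' ts)"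
  using assms(1,4)
proof (induction ts arbitrary: S)
  case (Cons t ts)
  then obtain X Y where S: "S = X \<union> Y" "X \<in> insert {} (f t)" "Y \<in> joins (map f ts)" by auto
  have "g X \<in> insert {} (f' t)" using S(2) Cons.prems(2)[of t X] assms(2) by auto
  moreover have "g Y \<in> joins (map f' ts)" using Cons S(3) by auto
  ultimately show ?case using S(1) assms(3) by auto
qed (use assms(2) in simp)

lemma card_joins:
  assumes "\<forall>t\<in>set ts. finite (f t) \<and> card (f t) \<le> n t"
  shows "finite (joins (map f ts)) \<and> card (joins (map f ts)) \<le> (\<Prod>t\<leftarrow>ts. Suc (n t))"
  using assms
proof (induction ts)
  case (Cons t ts)
  have eq: "joins (map f (t # ts)) = (\<lambda>(X, Y). X \<union> Y) ` (insert {} (f t) \<times> joins (map f ts))"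
    by auto
  have fin: "finite (insert {} (f t) \<times> joins (map f ts))" using Cons by auto
  have "card (insert {} (f t)) \<le> Suc (n t)"
    using Cons.prems card_insert_le_m1[of "Suc (n t)" "f t"] by auto
  then have "card (insert {} (f t) \<times> joins (map f ts)) \<le> Suc (n t) * (\<Prod>t\<leftarrow>ts. Suc (n t))"
    using Cons unfolding card_cartesian_product by (intro mult_mono) auto
  then show ?case
    unfolding eq using card_image_le[OF fin, of "\<lambda>(X, Y). X \<union> Y"] fin by auto
qed simp

lemma card_top_regions: "finite (top_regions t) \<and> card (top_regions t) \<le> num_top t"
proof (induction t)
  case (Node x ts)
  then have *: "finite (joins (map top_regions ts)) \<and> card (joins (map top_regions ts)) \<le> num_top (Node x ts)"
    using card_joins[of ts top_regions num_top] by auto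
  then show ?case using card_image_le[of "joins (map top_regions ts)" "insert x"] by auto
qed

lemma card_deep_regions: "finite (deep_regions t) \<and> card (deep_regions t) \<le> num_deep t"
proof (induction t)
  case (Node x ts)
  have j: "finite (joins (map top_regions ts))" "card (joins (map top_regions ts)) \<le> (\<Prod>t\<leftarrow>ts. Suc (num_top t))"
    using card_joins[of ts top_regions num_top] card_top_regions by auto
  have u: "finite (\<Union>t\<in>set ts. deep_regions t)" using Node by auto
  have "card (\<Union>t\<in>set ts. deep_regions t) \<le> (\<Sum>t\<in>set ts. card (deep_regions t))"
    by (rule card_UN_le) simp
  also have "\<dots> \<le> (\<Sum>t\<in>set ts. num_deep t)" by (rule sum_mono) (use Node in auto)
  also have "\<dots> \<le> (\<Sum>t\<leftarrow>ts. num_deep t)"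
    by (induction ts) (auto simp: sum.insert_if)
  finally have "card (\<Union>t\<in>set ts. deep_regions t) \<le> (\<Sum>t\<leftarrow>ts. num_deep t)" .
  moreover have "card (joins (map top_regions ts) - {{}}) \<le> (\<Prod>t\<leftarrow>ts. Suc (num_top t)) - 1"
    using j by (simp add: card_Diff_singleton)
  ultimately show ?case
    using j(1) u card_Un_le[of "joins (map top_regions ts) - {{}}" "\<Union>t\<in>set ts. deep_regions t"] by simp
qed

lemma joins_singletons: "S \<subseteq> set ws \<Longrightarrow> S \<in> joins (map (\<lambda>w. {{w}}) ws)"
proof (induction ws arbitrary: S)
  case (Cons w ws)
  have "S - {w} \<in> joins (map (\<lambda>w. {{w}}) ws)"
    using Cons.prems by (intro Cons.IH) auto
  moreover have "S \<inter> {w} \<in> insert {} {{w}}" by auto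
  moreover have "S = (S \<inter> {w}) \<union> (S - {w})" by auto
  ultimately show ?case using joins_ConsI[of "S \<inter> {w}" "{{w}}" "S - {w}"] by simp
qed simp

section \<open>Grafting trees\<close>

text \<open>
The trees \<open>us\<close> become additional children of every vertex labelled \<open>x\<close>. In the applications this
is a single leaf.
\<close>

fun graft :: "'a \<Rightarrow> 'a rtree list \<Rightarrow> 'a rtree \<Rightarrow> 'a rtree" where
  "graft x us (Node y ts) = Node y ((if y = x then us else []) @ map (graft x us) ts)"

text \<open>
A region of the old tree that contains \<open>x\<close> may be continued into the new branches by any choice
\<open>R\<close> of regions there; a region that misses \<open>x\<close> stays as it is.
\<close>

lemma top_regions_graft:
  assumes "S \<in> top_regions t" "R \<in> joins (map top_regions us)"
  shows "S \<union> (if x \<in> S then R else {}) \<in> top_regions (graft x us t)"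
  using assms(1)
proof (induction t arbitrary: S)
  case (Node y ts)
  let ?g = "\<lambda>S. S \<union> (if x \<in> S then R else {})"
  obtain B where B: "S = insert y B" "B \<in> joins (map top_regions ts)" using Node.prems by auto
  have gB: "?g B \<in> joins (map (top_regions \<circ> graft x us) ts)"
    using B(2) by (rule joins_map) (use Node.IH in auto)
  show ?case
  proof (cases "y = x")
    case True
    have "R \<union> ?g B \<in> joins (map top_regions us @ map (top_regions \<circ> graft x us) ts)"
      using assms(2) gB by (rule joins_appendI)
    moreover have "?g S = insert y (R \<union> ?g B)" using B True by auto
    ultimately show ?thesis using True by auto
  next
    case False
    moreover have "?g S = insert y (?g B)" using B False by auto
    ultimately show ?thesis using gB by auto
  qed
qed

lemma deep_regions_graft:
  assumes "S \<in> deep_regions t" "R \<in> joins (map top_regions us)"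
  shows "S \<union> (if x \<in> S then R else {}) \<in> deep_regions (graft x us t)"
  using assms(1)
proof (induction t arbitrary: S)
  case (Node y ts)
  let ?g = "\<lambda>S. S \<union> (if x \<in> S then R else {})"
  consider "S \<in> joins (map top_regions ts)" "S \<noteq> {}" | t where "t \<in> set ts" "S \<in> deep_regions t"
    using Node.prems by auto
  then show ?case
  proof cases
    case 1
    have "?g S \<in> joins (map (top_regions \<circ> graft x us) ts)"
      using 1(1) by (rule joins_map) (use top_regions_graft[OF _ assms(2)] in auto)
    then have "{} \<union> ?g S \<in> joins (map top_regions (if y = x then us else []) @ map (top_regions \<circ> graft x us) ts)"
      by (intro joins_appendI) simp_all
    moreover have "?g S \<noteq> {}" using 1(2) by auto
    ultimately show ?thesis by simp
  next
    case 2
    then have "?g S \<in> deep_regions (graft x us t)" using Node.IH by blast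
    then show ?thesis using 2(1) by (auto simp: bex_Un)
  qed
qed

lemma set_mset_sum_list: "set_mset (\<Sum>t\<leftarrow>ts. f t) = (\<Union>t\<in>set ts. set_mset (f t))"
  by (induction ts) auto

lemma deep_regions_grafted:
  assumes "x \<in># labels t" "R \<in> deep_regions (Node x us)"
  shows "R \<in> deep_regions (graft x us t)"
  using assms(1)
proof (induction t)
  case (Node y ts)
  show ?case
  proof (cases "y = x")
    case True
    have "R \<union> {} \<in> joins (map top_regions us @ map (top_regions \<circ> graft x us) ts)" if "R \<in> joins (map top_regions us)"
      using that by (intro joins_appendI) simp_all
    then show ?thesis using assms(2) True by auto
  next
    case False
    then obtain s where "s \<in> set ts" "x \<in># labels s"
      using Node.prems by (auto simp: set_mset_sum_list)
    then show ?thesis using Node.IH False by auto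
  qed
qed

text \<open>
Multiplicities make this additive over the children, so that a plain induction applies. In the
applications \<open>x\<close> occurs once.
\<close>

lemma labels_graft: "labels (graft x us t) = labels t + repeat_mset (count (labels t) x) (\<Sum>u\<leftarrow>us. labels u)"
proof (induction t)
  case (Node y ts)
  have "(\<Sum>s\<leftarrow>ts. labels (graft x us s))
    = (\<Sum>s\<leftarrow>ts. labels s) + repeat_mset (count (\<Sum>s\<leftarrow>ts. labels s) x) (\<Sum>u\<leftarrow>us. labels u)"
    using Node.IH by (induction ts) (auto simp: repeat_mset_distrib)
  then show ?case by (simp add: o_def)
qed

text \<open>
The leaves labelled \<open>x\<close> cease to be leaves. They are added on the left-hand side, because
subtraction of multisets is not additive.
\<close>

lemma leaves_graft:
  assumes "us \<noteq> []"
  shows "leaves (graft x us t) + repeat_mset (count (leaves t) x) {#x#}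
    = leaves t + repeat_mset (count (labels t) x) (\<Sum>u\<leftarrow>us. leaves u)"
proof (induction t)
  case (Node y ts)
  have "(\<Sum>s\<leftarrow>ts. leaves (graft x us s)) + repeat_mset (count (\<Sum>s\<leftarrow>ts. leaves s) x) {#x#}
    = (\<Sum>s\<leftarrow>ts. leaves s) + repeat_mset (count (\<Sum>s\<leftarrow>ts. labels s) x) (\<Sum>u\<leftarrow>us. leaves u)"
    using Node.IH
  proof (induction ts)
    case (Cons s ts)
    let ?r = "\<lambda>n. repeat_mset n {#x#}" and ?R = "\<lambda>n. repeat_mset n (\<Sum>u\<leftarrow>us. leaves u)"
    have "(leaves (graft x us s) + ?r (count (leaves s) x))
        + ((\<Sum>s\<leftarrow>ts. leaves (graft x us s)) + ?r (count (\<Sum>s\<leftarrow>ts. leaves s) x))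
      = (leaves s + ?R (count (labels s) x)) + ((\<Sum>s\<leftarrow>ts. leaves s) + ?R (count (\<Sum>s\<leftarrow>ts. labels s) x))"
      using Cons by simp
    then show ?case
      by (simp only: list.map sum_list.Cons count_union repeat_mset_distrib ac_simps)
  qed simp
  then show ?case using assms by (cases "ts = []") (auto simp: o_def ac_simps)
qed

section \<open>Covering a connected graph by a tree\<close>

text \<open>
Two pieces glued along \<open>x\<close>: a vertex other than \<open>x\<close> is a cut vertex of the whole exactly if it is
one of its own piece.
\<close>

lemma conn_remove_iff:
  assumes E: "sym E" and A: "conn E (P \<union> Q)" and PQ: "P \<inter> Q = {x}"
    and sep: "\<And>y z. y \<in> P - {x} \<Longrightarrow> z \<in> Q - {x} \<Longrightarrow> (y, z) \<notin> E"
    and v: "v \<in> P - {x}"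
  shows "conn E (P \<union> Q - {v}) \<longleftrightarrow> conn E (P - {v})"
proof
  assume c: "conn E (P \<union> Q - {v})"
  have "x \<in> P \<union> Q - {v}" using PQ v by auto
  then have "conn E ((P \<union> Q - {v}) \<inter> P)"
    using conn_split[OF E PQ sep c] by blast
  moreover have "(P \<union> Q - {v}) \<inter> P = P - {v}" by auto
  ultimately show "conn E (P - {v})" by simp
next
  assume c: "conn E (P - {v})"
  have "conn E ((P \<union> Q) \<inter> Q)" using conn_split[OF E PQ sep A] PQ by blast
  then have "conn E Q" by (simp add: Int_absorb1)
  then have "conn E (P - {v} \<union> Q)" using c E PQ v by (intro conn_Un) auto
  moreover have "P - {v} \<union> Q = P \<union> Q - {v}" using PQ v by blast
  ultimately show "conn E (P \<union> Q - {v})" by simp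
qed

text \<open>
The regions of such a tree bound the connected subsets of \<open>A\<close>. Those through the root are kept
apart, because only they extend further when the tree is grafted onto another one. The condition on
leaves excepts \<open>A = {r}\<close>, where the root itself is a leaf.
\<close>

definition tree_cover :: "'a rel \<Rightarrow> 'a set \<Rightarrow> 'a \<Rightarrow> 'a rtree \<Rightarrow> bool" where
  "tree_cover E A r t \<longleftrightarrow> (\<exists>ts. t = Node r ts) \<and> labels t = mset_set A \<and>
     (A \<noteq> {r} \<longrightarrow> leaves t = mset_set {v \<in> A - {r}. conn E (A - {v})}) \<and>
     (\<forall>S\<subseteq>A. conn E S \<longrightarrow> S \<in> (if r \<in> S then top_regions t else deep_regions t))"

text \<open>
If \<open>r\<close> is the only possible cut vertex, all other vertices can be hung on \<open>r\<close>: then every nonempty set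
is a region.
\<close>

lemma tree_cover_star:
  assumes "finite A" "r \<in> A" "\<And>v. v \<in> A - {r} \<Longrightarrow> conn E (A - {v})"
  shows "\<exists>t. tree_cover E A r t"
proof -
  obtain ws where ws: "set ws = A - {r}" "distinct ws"
    using finite_distinct_list[of "A - {r}"] assms(1) by auto
  have ms: "mset ws = mset_set (A - {r})" using ws mset_set_set by metis
  define t where "t = Node r (map (\<lambda>w. Node w []) ws)"
  have sum: "(\<Sum>w\<leftarrow>ws. {#w#}) = mset ws" by (induction ws) auto
  have "labels t = mset_set A"
    using mset_set.remove[OF assms(1,2)] by (simp add: t_def o_def sum ms)
  moreover have "leaves t = mset_set {v \<in> A - {r}. conn E (A - {v})}" if "A \<noteq> {r}"
  proof -
    have "A - {r} \<noteq> {}" using that assms(2) by blast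
    then have "ws \<noteq> []" using ws(1) by force
    then have "leaves t = mset_set (A - {r})" by (simp add: t_def o_def sum ms)
    moreover have "{v \<in> A - {r}. conn E (A - {v})} = A - {r}" using assms(3) by blast
    ultimately show ?thesis by (simp only:)
  qed
  moreover have "S \<in> (if r \<in> S then top_regions t else deep_regions t)" if "S \<subseteq> A" "conn E S" for S
  proof -
    have j: "S - {r} \<in> joins (map (\<lambda>w. {{w}}) ws)" using that(1) ws(1) by (intro joins_singletons) auto
    show ?thesis
    proof (cases "r \<in> S")
      case True
      have "insert r (S - {r}) \<in> top_regions t"
        using imageI[OF j, of "insert r"] by (simp add: t_def o_def del: insert_Diff_single)
      then show ?thesis using True by (simp add: insert_absorb)
    next
      case False
      then show ?thesis using j conn_nonempty[OF that(2)] by (auto simp: t_def o_def)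
    qed
  qed
  ultimately show ?thesis unfolding tree_cover_def t_def by blast
qed

text \<open>
The tree of the far side \<open>Q\<close> is rooted at the cut vertex \<open>x\<close>, which is a leaf in the tree of the near
side \<open>P\<close>, so the two fit together there. A connected set is contained in one side without \<open>x\<close>, or it
contains \<open>x\<close> and has connected traces on both sides; each case is a region of the grafted tree.
\<close>

lemma tree_cover_graft:
  assumes E: "sym E" and A: "finite (P \<union> Q)" "conn E (P \<union> Q)" and PQ: "P \<inter> Q = {x}"
    and sep: "\<And>y z. y \<in> P - {x} \<Longrightarrow> z \<in> Q - {x} \<Longrightarrow> (y, z) \<notin> E"
    and r: "r \<in> P - {x}" and Q: "Q \<noteq> {x}" and Px: "conn E (P - {x})" and x: "\<not> conn E (P \<union> Q - {x})"
    and t: "tree_cover E P r t" and u: "tree_cover E Q x (Node x us)"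
  shows "tree_cover E (P \<union> Q) r (graft x us t)"
proof -
  have fin: "finite P" "finite Q" using A(1) by auto
  have us: "us \<noteq> []"
  proof
    assume "us = []"
    then have "mset_set Q = {#x#}" using u by (simp add: tree_cover_def)
    then have "set_mset (mset_set Q) = {x}" by simp
    then show False using Q fin by simp
  qed
  have lt: "labels t = mset_set P" and lu: "labels (Node x us) = mset_set Q"
    using t u by (auto simp: tree_cover_def)
  have xP: "x \<in> P" "x \<in> Q" using PQ by auto
  have count_lt: "count (labels t) x = 1" using lt xP fin by simp
  have A_eq: "P \<union> Q = P \<union> (Q - {x})" "P \<inter> (Q - {x}) = {}" using PQ by auto
  have lus: "(\<Sum>u\<leftarrow>us. labels u) = mset_set (Q - {x})"
    using lu mset_set.remove[OF fin(2) xP(2)] by simp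
  have "labels (graft x us t) = mset_set P + mset_set (Q - {x})"
    unfolding labels_graft count_lt lus by (simp add: lt)
  also have "\<dots> = mset_set (P \<union> Q)"
    using A_eq fin by (metis finite_Diff mset_set_Union)
  finally have labels: "labels (graft x us t) = mset_set (P \<union> Q)" .
  let ?N = "{v \<in> P \<union> Q - {r}. conn E (P \<union> Q - {v})}"
  let ?NP = "{v \<in> P - {r}. conn E (P - {v})}" and ?NQ = "{v \<in> Q - {x}. conn E (Q - {v})}"
  have tt: "leaves t = mset_set ?NP"
    using t r xP by (auto simp: tree_cover_def)
  have tu: "(\<Sum>u\<leftarrow>us. leaves u) = mset_set ?NQ"
    using u Q us by (simp add: tree_cover_def)
  have NP: "conn E (P \<union> Q - {v}) \<longleftrightarrow> conn E (P - {v})" if "v \<in> P - {x}" for v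
    using conn_remove_iff[OF E A(2) PQ sep that] .
  have NQ: "conn E (P \<union> Q - {v}) \<longleftrightarrow> conn E (Q - {v})" if "v \<in> Q - {x}" for v
    using conn_remove_iff[of E Q P x v] E A(2) PQ sep that by (auto simp: Un_commute Int_commute dest: symD)
  have x_leaf: "x \<in> ?NP" using Px r xP by auto
  have count_tt: "count (leaves t) x = 1" using tt x_leaf fin by simp
  have "?N = (?NP - {x}) \<union> ?NQ"
    using NP NQ x r PQ by blast
  moreover have "(?NP - {x}) \<inter> ?NQ = {}" using PQ by blast
  ultimately have "mset_set ?N = mset_set (?NP - {x}) + mset_set ?NQ"
    using fin by (simp add: mset_set_Union)
  moreover have "mset_set ?NP = add_mset x (mset_set (?NP - {x}))"
    using x_leaf fin by (intro mset_set.remove) auto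
  moreover have "leaves (graft x us t) + {#x#} = mset_set ?NP + mset_set ?NQ"
    using leaves_graft[OF us, of x t] unfolding count_lt count_tt tu tt[symmetric] by simp
  ultimately have leaves: "leaves (graft x us t) = mset_set ?N" by simp
  have "S \<in> (if r \<in> S then top_regions (graft x us t) else deep_regions (graft x us t))"
    if S: "S \<subseteq> P \<union> Q" "conn E S" for S
  proof -
    have cov_t: "T \<in> (if r \<in> T then top_regions t else deep_regions t)" if "T \<subseteq> P" "conn E T" for T
      using t that by (auto simp: tree_cover_def)
    have cov_u: "T \<in> (if x \<in> T then top_regions (Node x us) else deep_regions (Node x us))" if "T \<subseteq> Q" "conn E T" for T
      using u that unfolding tree_cover_def by blast
    have ext: "T \<union> (if x \<in> T then R else {}) \<in> (if r \<in> T then top_regions (graft x us t) else deep_regions (graft x us t))"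
      if "T \<subseteq> P" "conn E T" "R \<in> joins (map top_regions us)" for T R
      using cov_t[OF that(1,2)] top_regions_graft[OF _ that(3), of T t x] deep_regions_graft[OF _ that(3), of T t x]
      by presburger
    consider "S \<subseteq> P - {x}" | "S \<subseteq> Q - {x}" | "x \<in> S" "conn E (S \<inter> P)" "conn E (S \<inter> Q)"
      using conn_split[OF E PQ sep S(2,1)] by blast
    then show ?thesis
    proof cases
      case 1
      then have "x \<notin> S" "S \<subseteq> P" by auto
      then show ?thesis using ext[of S "{}"] S(2) by simp
    next
      case 2
      then have "S \<subseteq> Q" "x \<notin> S" "r \<notin> S" using r PQ by auto
      moreover have "x \<in># labels t" using lt xP fin by simp
      ultimately show ?thesis
        using cov_u[of S] S(2) deep_regions_grafted[of x t S us] by simp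
    next
      case 3
      then have "S \<inter> Q \<in> top_regions (Node x us)" using cov_u[of "S \<inter> Q"] xP by simp
      then obtain R where R: "R \<in> joins (map top_regions us)" "S \<inter> Q = insert x R" by auto
      have "S = (S \<inter> P) \<union> (S \<inter> Q)" using S(1) by blast
      then have "(S \<inter> P) \<union> R = S" unfolding R(2) using 3(1) xP by blast
      moreover have "x \<in> S \<inter> P" "r \<in> S \<inter> P \<longleftrightarrow> r \<in> S" using 3(1) xP r by auto
      ultimately show ?thesis using ext[OF _ 3(2) R(1)] by simp
    qed
  qed
  moreover have "\<exists>ts. graft x us t = Node r ts" using t by (auto simp: tree_cover_def)
  ultimately show ?thesis using labels leaves unfolding tree_cover_def by blast
qed

text \<open>
Split at any cut vertex \<open>x\<close> other than \<open>r\<close>. The near side consists of \<open>x\<close> and the component of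
\<open>r\<close> in \<open>A - {x}\<close>, the far side of \<open>x\<close> and all other components. Both are smaller than \<open>A\<close>.
\<close>

lemma tree_cover_exists:
  assumes E: "sym E"
  shows "finite A \<Longrightarrow> conn E A \<Longrightarrow> r \<in> A \<Longrightarrow> \<exists>t. tree_cover E A r t"
proof (induction "card A" arbitrary: A r rule: less_induct)
  case less
  show ?case
  proof (cases "\<exists>x\<in>A - {r}. \<not> conn E (A - {x})")
    case False
    then show ?thesis using tree_cover_star less.prems by metis
  next
    case True
    then obtain x where x: "x \<in> A" "x \<noteq> r" "\<not> conn E (A - {x})" by auto
    \<comment> \<open>The vertices that \<open>r\<close> reaches without passing through \<open>x\<close>.\<close>
    define R where "R = {y. (r, y) \<in> (Restr E (A - {x}))\<^sup>*}"
    have R_sub: "R \<subseteq> A - {x}"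
    proof
      fix y assume "y \<in> R"
      then have "(r, y) \<in> (Restr E (A - {x}))\<^sup>*" by (simp add: R_def)
      then show "y \<in> A - {x}" by (rule rtrancl_Restr_in) (use less.prems(3) x(2) in simp)
    qed
    have rR: "r \<in> R" by (simp add: R_def)
    have R_step: "z \<in> R" if "y \<in> R" "(y, z) \<in> E" "z \<in> A - {x}" for y z
    proof -
      have "(y, z) \<in> Restr E (A - {x})" using that R_sub by auto
      then show ?thesis using that(1) unfolding R_def by (auto intro: rtrancl_into_rtrancl)
    qed
    have "conn E R"
    proof (rule conn_fromI[OF E rR])
      fix y assume "y \<in> R"
      then have "(r, y) \<in> (Restr E (A - {x}))\<^sup>*" by (simp add: R_def)
      then show "(r, y) \<in> (Restr E R)\<^sup>*"
      proof (induction rule: rtrancl_induct)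
        case (step y z)
        then have "y \<in> R" "z \<in> R" by (auto simp: R_def intro: rtrancl_into_rtrancl)
        then have "(y, z) \<in> Restr E R" using step.hyps(2) by auto
        with step.IH show ?case by (rule rtrancl_into_rtrancl)
      qed simp
    qed
    define P where "P = insert x R"
    define Q where "Q = A - R"
    have PQ: "P \<union> Q = A" "P \<inter> Q = {x}" using R_sub x(1) by (auto simp: P_def Q_def)
    have sep: "(y, z) \<notin> E" if "y \<in> P - {x}" "z \<in> Q - {x}" for y z
      using that R_step by (auto simp: P_def Q_def)
    have Px: "P - {x} = R" using R_sub by (auto simp: P_def)
    have Q: "Q \<noteq> {x}"
    proof
      assume "Q = {x}"
      then have "A - {x} = R" using PQ Px by blast
      then show False using x(3) \<open>conn E R\<close> by simp
    qed
    have cPQ: "conn E P" "conn E Q"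
      using conn_split[OF E PQ(2) sep, of A] PQ less.prems(2) by (auto simp: Int_absorb1 Un_upper1)
    have "P \<subset> A" "Q \<subset> A" using PQ Q rR by (auto simp: Q_def P_def)
    then have "card P < card A" "card Q < card A" using less.prems(1) by (simp_all add: psubset_card_mono)
    moreover have "finite P" "finite Q" using less.prems(1) PQ(1) by auto
    ultimately obtain t u where t: "tree_cover E P r t" and u: "tree_cover E Q x u"
      using less.hyps[of P r] less.hyps[of Q x] cPQ PQ rR P_def by auto
    obtain us where us: "u = Node x us" using u by (auto simp: tree_cover_def)
    have "tree_cover E (P \<union> Q) r (graft x us t)"
      by (rule tree_cover_graft[OF E _ _ PQ(2) sep _ Q])
        (use t u us PQ(1) Px rR less.prems x \<open>conn E R\<close> in auto)
    then show ?thesis using PQ(1) by auto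
  qed
qed

section \<open>Merging the forks of a tree\<close>

text \<open>
This number decreases in every merging step and so bounds how many of them are possible.
\<close>

fun forks :: "'a rtree \<Rightarrow> nat" where
  "forks (Node x ts) = (if length ts \<ge> 2 then 1 else 0) + (\<Sum>t\<leftarrow>ts. forks t)"

definition stalk :: "'a list \<Rightarrow> 'a rtree \<Rightarrow> 'a rtree" where
  "stalk xs t = foldr (\<lambda>x t. Node x [t]) xs t"

lemma stalk_simps [simp]: "stalk [] t = t" "stalk (x # xs) t = Node x [stalk xs t]"
  by (simp_all add: stalk_def)

lemma stalk_append: "stalk (xs @ ys) t = stalk xs (stalk ys t)"
  by (simp add: stalk_def)

lemma choose_two_Suc: "Suc m choose 2 = (m choose 2) + m"
  by (simp add: numeral_2_eq_2)

lemma choose_two_add: "(m + n) choose 2 = (m choose 2) + (n choose 2) + m * n"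
  by (induction n) (simp_all add: choose_two_Suc)

lemma labels_stalk [simp]: "labels (stalk xs t) = mset xs + labels t"
  by (induction xs) auto

lemma leaves_stalk [simp]: "leaves (stalk xs t) = leaves t"
  by (induction xs) auto

lemma forks_stalk [simp]: "forks (stalk xs t) = forks t"
  by (induction xs) auto

lemma num_top_stalk: "num_top (stalk xs t) = length xs + num_top t"
  by (induction xs) auto

lemma num_deep_stalk: "num_deep (stalk xs t) = num_deep t + length xs * num_top t + (length xs choose 2)"
  by (induction xs) (auto simp: num_top_stalk choose_two_Suc)

lemma prod_list_Suc_pos: "(\<Prod>t\<leftarrow>ts. Suc (f t)) \<ge> 1"
  by (induction ts) auto

lemma num_top_pos: "num_top t \<ge> 1"
  by (cases t) (use prod_list_Suc_pos[of num_top] in simp)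

lemma prod_list_Suc_num_top_ge_2: "ts \<noteq> [] \<Longrightarrow> (\<Prod>t\<leftarrow>ts. Suc (num_top t)) \<ge> 2"
proof (cases ts)
  case (Cons t us)
  have "2 * 1 \<le> Suc (num_top t) * (\<Prod>t\<leftarrow>us. Suc (num_top t))"
    using num_top_pos[of t] prod_list_Suc_pos[of num_top us] by (intro mult_mono) auto
  then show ?thesis using Cons by simp
qed simp

text \<open>
The number of regions of a tree, exposed at its first vertex \<open>v\<close> that may branch. It is stated in the
integers, in the shape needed for comparing two trees by subtraction.
\<close>

lemma total_stalk:
  "int (num_top (stalk xs (Node v ts)) + num_deep (stalk xs (Node v ts)))
    = (int (length xs) + 2) * (\<Prod>t\<leftarrow>ts. 1 + int (num_top t))
      + int (Suc (length xs) choose 2) + (\<Sum>t\<leftarrow>ts. int (num_deep t)) - 1"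
proof -
  have P: "int (\<Prod>t\<leftarrow>ts. Suc (num_top t)) = (\<Prod>t\<leftarrow>ts. 1 + int (num_top t))"
    by (induction ts) (auto simp: algebra_simps)
  have S: "int (\<Sum>t\<leftarrow>ts. num_deep t) = (\<Sum>t\<leftarrow>ts. int (num_deep t))"
    by (induction ts) auto
  show ?thesis
    using prod_list_Suc_pos[of num_top ts]
    by (simp add: num_top_stalk num_deep_stalk choose_two_Suc P[symmetric] S[symmetric] of_nat_diff algebra_simps)
qed

text \<open>
Here \<open>v\<close> is the topmost branching vertex and \<open>u\<close> the next one on some path down from \<open>v\<close>. Let \<open>W = m + 1\<close> be the number of
vertices from the root to \<open>v\<close> and \<open>h = j + 1\<close> the distance from \<open>v\<close> to \<open>u\<close>. Let \<open>Q\<close> and \<open>P\<close> be the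
products of \<open>1 + num_top\<close> over the other children of \<open>v\<close> and over the children of \<open>u\<close>. Let \<open>w\<close> be
a child of \<open>u\<close>, with \<open>num_top w = a\<close>, and \<open>P = (1 + a) * P'\<close>.
Hanging the other children of \<open>v\<close> on \<open>u\<close> gains \<open>h * (Q - 1) * (P - W - 1)\<close> regions; hanging
the children of \<open>u\<close> other than \<open>w\<close> on \<open>v\<close> gains \<open>h * (P' - 1) * ((W + 1) * Q - (1 + a))\<close>.
If the first gain is not positive, then \<open>1 + a < P \<le> W + 1\<close>, and the second one is.
\<close>

lemma merge_forks:
  fixes xs ys :: "'a list" and u v :: 'a
  assumes "length us \<ge> 2" "ts @ ts' \<noteq> []"
  defines "t \<equiv> stalk xs (Node v (ts @ stalk ys (Node u us) # ts'))"
  shows "\<exists>t'. labels t' = labels t \<and> leaves t' = leaves t \<and> forks t' < forks t \<and>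
    num_top t + num_deep t < num_top t' + num_deep t'"
proof -
  obtain w us' where us: "us = w # us'" "us' \<noteq> []"
    using assms(1) by (cases us; cases "tl us") auto
  define ss where "ss = ts @ ts'"
  \<comment> \<open>The two candidates: all children of \<open>u\<close> but \<open>w\<close> move up to
    \<open>v\<close>, or the other children of \<open>v\<close> move down to \<open>u\<close>.\<close>
  define tA where "tA = stalk xs (Node v (stalk (ys @ [u]) w # us' @ ss))"
  define tB where "tB = stalk (xs @ v # ys) (Node u (us @ ss))"
  define Q where "Q = (\<Prod>t\<leftarrow>ss. 1 + int (num_top t))"
  define P' where "P' = (\<Prod>t\<leftarrow>us'. 1 + int (num_top t))"
  define P where "P = (\<Prod>t\<leftarrow>us. 1 + int (num_top t))"
  define a where "a = int (num_top w)"
  define b where "b = (\<Sum>t\<leftarrow>ss @ us. int (num_deep t))"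
  define m where "m = int (length xs)"
  define j where "j = int (length ys)"
  have int_prod: "int (\<Prod>t\<leftarrow>ss. Suc (num_top t)) = (\<Prod>t\<leftarrow>ss. 1 + int (num_top t))" for ss :: "'a rtree list"
    by (induction ss) (auto simp: algebra_simps)
  have int_sum: "int (\<Sum>t\<leftarrow>ss. num_deep t) = (\<Sum>t\<leftarrow>ss. int (num_deep t))" for ss :: "'a rtree list"
    by (induction ss) auto
  have ge_2: "(\<Prod>t\<leftarrow>ss. 1 + int (num_top t)) \<ge> 2" if "ss \<noteq> []" for ss :: "'a rtree list"
    using prod_list_Suc_num_top_ge_2[OF that] unfolding int_prod[symmetric] by linarith
  have Q2: "Q \<ge> 2" and P'2: "P' \<ge> 2"
    using ge_2[of ss] ge_2[of us'] assms(2) us(2) by (auto simp: Q_def P'_def ss_def)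
  have P: "P = (1 + a) * P'" by (simp add: P_def P'_def us a_def)
  have a: "a \<ge> 1" using num_top_pos[of w] by (simp add: a_def)
  have nn: "m \<ge> 0" "j \<ge> 0" by (auto simp: m_def j_def)
  define N where "N = (\<lambda>t :: 'a rtree. int (num_top t + num_deep t))"
  have prod_t: "(\<Prod>s\<leftarrow>ts @ stalk ys (Node u us) # ts'. 1 + int (num_top s)) = Q * (1 + j + P)"
    using int_prod[of us] by (simp add: Q_def ss_def j_def P_def num_top_stalk algebra_simps)
  have sum_t: "(\<Sum>s\<leftarrow>ts @ stalk ys (Node u us) # ts'. int (num_deep s))
      = b + P - 1 + j * P + int (length ys choose 2)"
  proof -
    have "int (num_deep (Node u us)) = P - 1 + (\<Sum>t\<leftarrow>us. int (num_deep t))"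
      using prod_list_Suc_pos[of num_top us] int_prod[of us]
      by (simp add: P_def of_nat_diff int_sum)
    moreover have "int (num_top (Node u us)) = P" using int_prod[of us] by (simp add: P_def)
    ultimately show ?thesis
      by (simp only: map_append list.map sum_list.append sum_list.Cons num_deep_stalk of_nat_add
          of_nat_mult b_def ss_def j_def)
  qed
  have Nt: "N t = (m + 2) * (Q * (1 + j + P)) + int (Suc (length xs) choose 2)
      + b + P - 2 + j * P + int (length ys choose 2)"
    unfolding N_def t_def total_stalk prod_t sum_t by (simp add: m_def)
  have NtB: "N tB = (m + j + 3) * (P * Q) + int (Suc (Suc (length xs + length ys)) choose 2) + b - 1"
    unfolding N_def tB_def total_stalk by (simp add: m_def j_def P_def Q_def b_def algebra_simps)
  have NtA: "N tA = (m + 2) * ((2 + j + a) * (P' * Q)) + int (Suc (length xs) choose 2)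
      + b + (j + 1) * a + int (Suc (length ys) choose 2) - 1"
    unfolding N_def tA_def total_stalk
    by (simp add: m_def j_def P'_def Q_def b_def a_def us num_top_stalk num_deep_stalk algebra_simps)
  have gainB: "N tB - N t = (j + 1) * ((Q - 1) * (P - (m + 2)))"
    unfolding Nt NtB choose_two_Suc choose_two_add by (simp add: m_def j_def algebra_simps)
  have gainA: "N tA - N t = (j + 1) * ((P' - 1) * ((m + 2) * Q - (1 + a)))"
    unfolding Nt NtA choose_two_Suc P by (simp add: j_def algebra_simps)
  have forks_t: "forks t \<ge> 2 + (\<Sum>t\<leftarrow>us @ ss. forks t)"
    using assms(1,2) by (auto simp: t_def ss_def Suc_le_eq)
  show ?thesis
  proof (cases "P > m + 2")
    case True
    have "0 < (j + 1) * ((Q - 1) * (P - (m + 2)))" using True Q2 nn by (intro mult_pos_pos) auto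
    then have "N t < N tB" using gainB by simp
    moreover have "labels tB = labels t" "leaves tB = leaves t" "forks tB < forks t"
      using forks_t us assms(2) by (auto simp: tB_def t_def ss_def Suc_le_eq)
    ultimately show ?thesis unfolding N_def by (intro exI[of _ tB]) simp
  next
    case False
    have "2 * (m + 2) \<le> Q * (m + 2)" using Q2 nn by (intro mult_right_mono) auto
    moreover have "(1 + a) * 2 \<le> P" unfolding P using P'2 a by (intro mult_left_mono) auto
    ultimately have "(m + 2) * Q > 1 + a" using False a nn by (simp add: mult.commute)
    then have "0 < (j + 1) * ((P' - 1) * ((m + 2) * Q - (1 + a)))" using P'2 nn by (intro mult_pos_pos) auto
    then have "N t < N tA" using gainA by simp
    moreover have "labels tA = labels t" "leaves tA = leaves t" "forks tA < forks t"
      using forks_t us assms(2) by (auto simp: tA_def t_def ss_def Suc_le_eq)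
    ultimately show ?thesis unfolding N_def by (intro exI[of _ tA]) simp
  qed
qed

text \<open>
A path \<open>xs @ [v]\<close> from the root downwards, whose last vertex \<open>v\<close> carries the paths \<open>ls\<close>. The tree
that is a path along a nonempty list \<open>l\<close> appears as \<open>stalk (butlast l) (Node (last l) [])\<close>.
\<close>

definition broom :: "'a list \<Rightarrow> 'a \<Rightarrow> 'a list list \<Rightarrow> 'a rtree" where
  "broom xs v ls = stalk xs (Node v (map (\<lambda>l. stalk (butlast l) (Node (last l) [])) ls))"

lemma rtree_stalk_cases:
  obtains xs v ts where "t = stalk xs (Node v ts)" "length ts \<noteq> 1"
proof -
  have "\<exists>xs v ts. t = stalk xs (Node v ts) \<and> length ts \<noteq> 1"
  proof (induction t)
    case (Node x ts)
    show ?case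
    proof (cases "length ts = 1")
      case True
      then obtain s where s: "ts = [s]" by (cases ts) auto
      then obtain xs v us where "s = stalk xs (Node v us)" "length us \<noteq> 1"
        using Node.IH by auto
      then show ?thesis using s by (intro exI[of _ "x # xs"]) auto
    next
      case False
      then show ?thesis by (intro exI[of _ "[]"]) auto
    qed
  qed
  then show ?thesis using that by blast
qed

lemma broom_or_merge_forks:
  shows "(\<exists>xs v ls. t = broom xs v ls \<and> [] \<notin> set ls) \<or>
    (\<exists>t'. labels t' = labels t \<and> leaves t' = leaves t \<and> forks t' < forks t \<and>
    num_top t + num_deep t < num_top t' + num_deep t')"
proof -
  obtain xs v ts where t: "t = stalk xs (Node v ts)" "length ts \<noteq> 1" by (rule rtree_stalk_cases)
  show ?thesis
  proof (cases "\<forall>s\<in>set ts. \<exists>l. l \<noteq> [] \<and> s = stalk (butlast l) (Node (last l) [])")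
    case True
    then obtain f where f: "\<And>s. s \<in> set ts \<Longrightarrow> f s \<noteq> []"
      "\<And>s. s \<in> set ts \<Longrightarrow> stalk (butlast (f s)) (Node (last (f s)) []) = s"
      by metis
    have "map (\<lambda>s. stalk (butlast (f s)) (Node (last (f s)) [])) ts = ts"
      using f(2) by (rule map_idI)
    then have "t = broom xs v (map f ts)" by (simp add: t broom_def o_def)
    moreover have "[] \<notin> set (map f ts)" 
    proof
      assume "[] \<in> set (map f ts)"
      then obtain s where "s \<in> set ts" "f s = []" by (metis in_set_conv_nth length_map nth_map)
      then show False using f(1) by blast
    qed
    ultimately show ?thesis by blast
  next
    case False
    then obtain s where s: "s \<in> set ts" "\<And>l. l \<noteq> [] \<Longrightarrow> s \<noteq> stalk (butlast l) (Node (last l) [])" by blast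
    obtain ys u us where us: "s = stalk ys (Node u us)" "length us \<noteq> 1" by (rule rtree_stalk_cases)
    have "us \<noteq> []" using s(2)[of "ys @ [u]"] us(1) by auto
    then have "length us \<ge> 2" using us(2) by (cases us; cases "tl us") auto
    moreover obtain as bs where ts: "ts = as @ s # bs" using s(1) by (meson split_list)
    moreover have "as @ bs \<noteq> []" using t(2) ts by auto
    ultimately show ?thesis using merge_forks[of us as bs xs v ys u] by (simp add: t us)
  qed
qed

text \<open>
The number of connected induced subgraphs of \<open>G(n\<^sub>1; \<dots>; n\<^sub>k)\<close>: the first sum counts the intervals that
stay inside one path and avoid the clique, the product counts the ways to choose an initial piece of
every path, all empty excluded.
\<close>

definition clique_paths_count :: "nat multiset \<Rightarrow> nat" where
  "clique_paths_count M = (\<Sum>n\<in>#M. n choose 2) + (\<Prod>n\<in>#M. Suc n) - 1"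

lemma clique_paths_count_mset:
  "clique_paths_count (mset ns) = (\<Sum>n\<leftarrow>ns. n choose 2) + (\<Prod>n\<leftarrow>ns. Suc n) - 1"
  by (simp add: clique_paths_count_def sum_mset_sum_list[symmetric] prod_mset_prod_list[symmetric])

text \<open>
The path above the bristles counts as one more path, with its end \<open>v\<close> at the clique.
\<close>

lemma total_broom:
  assumes "[] \<notin> set ls"
  shows "num_top (broom xs v ls) + num_deep (broom xs v ls)
    = clique_paths_count (mset (Suc (length xs) # map length ls))"
proof -
  have r: "num_top (stalk (butlast l) (Node (last l) [])) = length l"
    and u: "num_deep (stalk (butlast l) (Node (last l) [])) = length l choose 2" if "l \<noteq> []" for l :: "'a list"
    using that by (cases l rule: rev_cases; simp add: num_top_stalk num_deep_stalk choose_two_Suc)+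
  have p: "(\<Prod>t\<leftarrow>map (\<lambda>l. stalk (butlast l) (Node (last l) [])) ls. 1 + int (num_top t))
    = int (prod_list (map (\<lambda>l. Suc (length l)) ls))"
    using assms by (induction ls) (auto simp: r algebra_simps)
  have s: "(\<Sum>t\<leftarrow>map (\<lambda>l. stalk (butlast l) (Node (last l) [])) ls. int (num_deep t))
    = int (sum_list (map (\<lambda>l. length l choose 2) ls))"
    using assms by (induction ls) (auto simp: u algebra_simps)
  have "int (num_top (broom xs v ls) + num_deep (broom xs v ls))
    = int (clique_paths_count (mset (Suc (length xs) # map length ls)))"
    unfolding broom_def total_stalk p s
    using prod_list_Suc_pos[of length ls]
    by (simp only: clique_paths_count_mset list.map map_map sum_list.Cons prod_list.Cons o_def)
      (simp add: of_nat_diff algebra_simps)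
  then show ?thesis by linarith
qed

lemma labels_broom: "[] \<notin> set ls \<Longrightarrow> labels (broom xs v ls) = mset (xs @ v # concat ls)"
proof -
  assume "[] \<notin> set ls"
  then have "sum_list (map (labels \<circ> (\<lambda>l. stalk (butlast l) (Node (last l) []))) ls) = mset (concat ls)"
  proof (induction ls)
    case (Cons l ls)
    have "mset l = add_mset (last l) (mset (butlast l))"
      using Cons.prems by (cases l rule: rev_cases) auto
    then show ?case using Cons by auto
  qed simp
  then show ?thesis by (simp add: broom_def)
qed

lemma leaves_broom: "leaves (broom xs v ls) = (if ls = [] then {#v#} else mset (map last ls))"
proof -
  have "(\<Sum>l\<leftarrow>ls. {#last l#}) = mset (map last ls)"
    by (induction ls) simp_all
  then show ?thesis by (simp add: broom_def o_def)
qed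

lemma broom_maximises:
  "\<exists>xs v ls. [] \<notin> set ls \<and> labels (broom xs v ls) = labels t \<and> leaves (broom xs v ls) = leaves t \<and>
    num_top t + num_deep t \<le> num_top (broom xs v ls) + num_deep (broom xs v ls) \<and>
    (num_top t + num_deep t = num_top (broom xs v ls) + num_deep (broom xs v ls) \<longrightarrow> t = broom xs v ls)"
proof (induction "forks t" arbitrary: t rule: less_induct)
  case less
  show ?case
    using broom_or_merge_forks[of t]
  proof (elim disjE exE conjE)
    fix xs v ls assume "t = broom xs v ls" "[] \<notin> set ls"
    then show ?thesis by (intro exI[of _ xs] exI[of _ v] exI[of _ ls]) simp
  next
    fix t' assume t': "labels t' = labels t" "leaves t' = leaves t" "forks t' < forks t"
      "num_top t + num_deep t < num_top t' + num_deep t'"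
    show ?thesis
      using less[OF t'(3)]
    proof (elim exE conjE)
      fix xs v ls assume "[] \<notin> set ls" "labels (broom xs v ls) = labels t'" "leaves (broom xs v ls) = leaves t'"
        "num_top t' + num_deep t' \<le> num_top (broom xs v ls) + num_deep (broom xs v ls)"
      then show ?thesis using t' by (intro exI[of _ xs] exI[of _ v] exI[of _ ls]) simp
    qed
  qed
qed

section \<open>Balancing the path lengths\<close>

text \<open>
The \<open>k\<close> numbers with sum \<open>n\<close> that differ pairwise by at most one.
\<close>

definition balanced :: "nat \<Rightarrow> nat \<Rightarrow> nat multiset" where
  "balanced n k = replicate_mset (k - n mod k) (n div k) + replicate_mset (n mod k) (Suc (n div k))"

lemma prod_mset_Suc_pos: "(\<Prod>n\<in>#M. int (Suc n)) \<ge> 1"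
proof (induction M)
  case (add n M)
  have "1 * 1 \<le> int (Suc n) * (\<Prod>n\<in>#M. int (Suc n))" using add by (intro mult_mono) auto
  then show ?case by simp
qed simp

lemma int_clique_paths_count:
  "int (clique_paths_count M) = (\<Sum>n\<in>#M. int (n choose 2)) + (\<Prod>n\<in>#M. int (Suc n)) - 1"
proof -
  have "(\<Prod>n\<in>#M. Suc n) \<ge> 1" by (induction M) auto
  moreover have "int (\<Sum>n\<in>#M. n choose 2) = (\<Sum>n\<in>#M. int (n choose 2))" by (induction M) auto
  moreover have "int (\<Prod>n\<in>#M. Suc n) = (\<Prod>n\<in>#M. int (Suc n))"
    by (induction M) (auto simp: algebra_simps)
  ultimately show ?thesis unfolding clique_paths_count_def by linarith
qed

text \<open>
The product gains \<open>(x + 2) * y - (x + 1) * (y + 1) = y - 1 - x\<close> for each of the choices made in the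
remaining paths, while the intervals off the clique lose the same number only once. For an empty \<open>M\<close> both effects cancel: a path can be cut at any place.
\<close>

lemma clique_paths_count_smooth:
  assumes "x + 2 \<le> y"
  shows "int (clique_paths_count (M + {#Suc x, y - 1#})) - int (clique_paths_count (M + {#x, y#}))
    = (int y - 1 - int x) * ((\<Prod>n\<in>#M. int (Suc n)) - 1)"
proof -
  obtain z where z: "y = Suc z" using assms by (cases y) auto
  show ?thesis
    unfolding int_clique_paths_count z by (simp add: choose_two_Suc algebra_simps)
qed

lemma balancedI:
  assumes "M \<noteq> {#}" "\<And>x y. x \<in># M \<Longrightarrow> y \<in># M \<Longrightarrow> y < x + 2"
  shows "M = balanced (sum_mset M) (size M)"
proof -
  \<comment> \<open>All elements are \<open>m\<close> or \<open>m + 1\<close>, and \<open>m\<close> occurs. So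
    the number \<open>b\<close> of elements \<open>m + 1\<close> is less than the size, which
    makes it the remainder.\<close>
  define m where "m = Min (set_mset M)"
  define b where "b = count M (Suc m)"
  have m: "m \<in># M" "\<And>x. x \<in># M \<Longrightarrow> m \<le> x"
    using assms(1) by (auto simp: m_def)
  then have two: "x = m \<or> x = Suc m" if "x \<in># M" for x
    using assms(2)[OF m(1) that] m(2)[OF that] by auto
  have M: "M = replicate_mset (count M m) m + replicate_mset b (Suc m)"
  proof (rule multiset_eqI)
    fix x
    have "count M x = 0" if "x \<noteq> m" "x \<noteq> Suc m" using two that by (metis not_in_iff)
    then show "count M x = count (replicate_mset (count M m) m + replicate_mset b (Suc m)) x"
      by (auto simp: b_def)
  qed
  have "count M m > 0" using m(1) by simp
  have size: "size M = count M m + b" by (subst M) simp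
  have "sum_mset M = count M m * m + b * Suc m" by (subst M) simp
  then have sum: "sum_mset M = b + m * size M" by (simp add: size algebra_simps)
  have "b < size M" using size \<open>count M m > 0\<close> by simp
  then have "sum_mset M div size M = m" "sum_mset M mod size M = b"
    unfolding sum by (simp_all only: div_mult_self1 mod_mult_self1) auto
  then show ?thesis unfolding balanced_def using M size by simp
qed

text \<open>
Smoothing two lengths that differ by at least two decreases the sum of squares, so it ends, and it ends in
the balanced lengths. With at least three lengths every smoothing step is a strict gain.
\<close>

lemma clique_paths_count_le_balanced:
  assumes "M \<noteq> {#}" "0 \<notin># M"
  shows "clique_paths_count M \<le> clique_paths_count (balanced (sum_mset M) (size M)) \<and>
    (size M \<ge> 3 \<longrightarrow> clique_paths_count M = clique_paths_count (balanced (sum_mset M) (size M)) \<longrightarrow>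
      M = balanced (sum_mset M) (size M))"
  using assms
proof (induction "\<Sum>n\<in>#M. n * n" arbitrary: M rule: less_induct)
  case less
  show ?case
  proof (cases "\<exists>x\<in>#M. \<exists>y\<in>#M. x + 2 \<le> y")
    case False
    then have "M = balanced (sum_mset M) (size M)"
      using less.prems(1) by (intro balancedI) (auto simp: not_le)
    then show ?thesis by simp
  next
    case True
    then obtain x y where xy: "x \<in># M" "y \<in># M" "x + 2 \<le> y" by auto
    then have "x \<noteq> y" by auto
    then obtain N where M: "M = N + {#x, y#}"
    proof -
      obtain N1 where N1: "M = add_mset x N1" using xy(1) by (metis multi_member_split)
      then obtain N where "N1 = add_mset y N" using xy(2) \<open>x \<noteq> y\<close> by (metis multi_member_split insert_noteq_member)
      then show ?thesis using N1 that[of N] by simp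
    qed
    define M' where "M' = N + {#Suc x, y - 1#}"
    obtain z where z: "y = Suc z" "Suc x \<le> z" using xy(3) by (cases y) auto
    have pos: "(\<Prod>n\<in>#N. int (Suc n)) \<ge> 1" by (rule prod_mset_Suc_pos)
    have "x * x + y * y > Suc x * Suc x + z * z" using z by (simp add: algebra_simps)
    then have dec: "(\<Sum>n\<in>#M'. n * n) < (\<Sum>n\<in>#M. n * n)" by (simp add: M M'_def z)
    have nz: "M' \<noteq> {#}" "0 \<notin># M'" using less.prems z by (auto simp: M M'_def)
    have same: "sum_mset M' = sum_mset M" "size M' = size M" using z by (simp_all add: M M'_def)
    note IH = less.hyps[OF dec nz, unfolded same]
    have gain: "int (clique_paths_count M') - int (clique_paths_count M)
      = (int y - 1 - int x) * ((\<Prod>n\<in>#N. int (Suc n)) - 1)"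
      unfolding M M'_def by (rule clique_paths_count_smooth[OF xy(3)])
    then have "clique_paths_count M \<le> clique_paths_count M'"
      using pos xy(3) mult_nonneg_nonneg[of "int y - 1 - int x" "(\<Prod>n\<in>#N. int (Suc n)) - 1"] by linarith
    moreover have "clique_paths_count M < clique_paths_count M'" if "size M \<ge> 3"
    proof -
      have "N \<noteq> {#}" using that by (auto simp: M)
      then obtain w N' where N: "N = add_mset w N'" using multiset_cases by metis
      have "w \<noteq> 0" using less.prems(2) by (auto simp: M N)
      have "(\<Prod>n\<in>#N'. int (Suc n)) \<ge> 1" by (rule prod_mset_Suc_pos)
      then have "int (Suc w) * (\<Prod>n\<in>#N'. int (Suc n)) \<ge> 2 * 1"
        using \<open>w \<noteq> 0\<close> by (intro mult_mono) auto
      then have "(\<Prod>n\<in>#N. int (Suc n)) \<ge> 2" by (simp add: N)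
      then show ?thesis
        using gain xy(3) mult_pos_pos[of "int y - 1 - int x" "(\<Prod>n\<in>#N. int (Suc n)) - 1"] by linarith
    qed
    ultimately show ?thesis using IH by auto
  qed
qed

lemma clique_paths_count_balanced:
  "clique_paths_count (balanced n k) = (k - n mod k) * ((n div k) choose 2) + n mod k * ((n div k + 1) choose 2)
    + (n div k + 1) ^ (k - n mod k) * (n div k + 2) ^ (n mod k) - 1"
  by (simp add: clique_paths_count_def balanced_def image_replicate_mset prod_mset_replicate_mset)

section \<open>Connected sets of clique-with-paths graphs\<close>

definition num_conn :: "'a rel \<Rightarrow> 'a set \<Rightarrow> nat" where
  "num_conn E V = card {S. S \<subseteq> V \<and> conn E S}"

lemma num_conn_induced_eq_num_conn:
  assumes "pair_graph H"
  shows "num_conn_induced (with_proj H) = num_conn (parcs H) (pverts H)"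
  using conn_nonempty[of "parcs H"]
  by (auto simp: num_conn_induced_def num_conn_def connected_induced_iff_conn[OF assms] intro!: arg_cong[where f = card])

text \<open>
An injective homomorphism sends connected sets to connected sets, injectively. The ends of an edge
that is not an image of an edge form a connected set that is not reached.
\<close>

lemma num_conn_embed:
  assumes "finite W" "inj_on f V" "f ` V \<subseteq> W"
    and edges: "\<And>x y. x \<in> V \<Longrightarrow> y \<in> V \<Longrightarrow> (x, y) \<in> E \<Longrightarrow> (f x, f y) \<in> F"
  shows "num_conn E V \<le> num_conn F W"
    and "\<lbrakk>sym F; p \<in> V; q \<in> V; p \<noteq> q; (f p, f q) \<in> F; (p, q) \<notin> E\<rbrakk> \<Longrightarrow> num_conn E V < num_conn F W"
proof -
  let ?A = "{S. S \<subseteq> V \<and> conn E S}" and ?B = "{S. S \<subseteq> W \<and> conn F S}"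
  have inj: "inj_on (image f) ?A"
    using inj_on_image_eq_iff[OF assms(2)] by (auto simp: inj_on_def)
  have sub: "image f ` ?A \<subseteq> ?B"
  proof safe
    fix S x assume "S \<subseteq> V" "x \<in> S"
    then show "f x \<in> W" using assms(3) by auto
  next
    fix S assume "S \<subseteq> V" "conn E S"
    then show "conn F (f ` S)" using edges by (intro conn_image) auto
  qed
  have fin: "finite ?B" using assms(1) by simp
  show "num_conn E V \<le> num_conn F W"
    unfolding num_conn_def using inj sub fin by (rule card_inj_on_le)
  show "num_conn E V < num_conn F W"
    if pq: "sym F" "p \<in> V" "q \<in> V" "p \<noteq> q" "(f p, f q) \<in> F" "(p, q) \<notin> E"
  proof -
    have "{f p, f q} \<notin> image f ` ?A"
    proof
      assume "{f p, f q} \<in> image f ` ?A"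
      then obtain S where S: "S \<subseteq> V" "conn E S" "f ` S = f ` {p, q}" by auto
      then have "S = {p, q}" using inj_on_image_eq_iff[OF assms(2) S(1), of "{p, q}"] pq by auto
      then show False using S(2) conn_pairD pq by metis
    qed
    moreover have "{f p, f q} \<in> ?B" using conn_pair pq assms(3) by auto
    ultimately have "image f ` ?A \<subset> ?B" using sub by blast
    then have "card (image f ` ?A) < card ?B" using fin by (rule psubset_card_mono[rotated])
    then show ?thesis unfolding num_conn_def card_image[OF inj] .
  qed
qed

lemma conn_path:
  assumes "sym E" "a < b" "\<And>i. a \<le> i \<Longrightarrow> Suc i < b \<Longrightarrow> (f i, f (Suc i)) \<in> E"
  shows "conn E (f ` {a..<b})"
proof (rule conn_fromI[OF assms(1), of "f a"])
  show "f a \<in> f ` {a..<b}" using assms(2) by simp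
  fix y assume "y \<in> f ` {a..<b}"
  then obtain i where i: "y = f i" "a \<le> i" "i < b" by auto
  have "i < b \<longrightarrow> (f a, f i) \<in> (Restr E (f ` {a..<b}))\<^sup>*"
    using i(2)
  proof (induction i rule: dec_induct)
    case (step m)
    show ?case
    proof
      assume m: "Suc m < b"
      then have "(f m, f (Suc m)) \<in> Restr E (f ` {a..<b})" using assms(3)[of m] step.hyps by auto
      then show "(f a, f (Suc m)) \<in> (Restr E (f ` {a..<b}))\<^sup>*"
        using step.IH m by (meson Suc_lessD rtrancl.rtrancl_into_rtrancl)
    qed
  qed simp
  then show "(f a, y) \<in> (Restr E (f ` {a..<b}))\<^sup>*" using i by simp
qed

lemma card_increasing_pairs: "card {(a, b). 1 \<le> a \<and> a < b \<and> b \<le> m} = m choose 2" for m :: nat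
proof (induction m)
  case 0
  have "{(a, b). 1 \<le> a \<and> a < b \<and> b \<le> (0::nat)} = {}" by auto
  then show ?case by (simp only: card.empty) simp
next
  case (Suc m)
  have eq: "{(a, b). 1 \<le> a \<and> a < b \<and> b \<le> Suc m}
    = {(a, b). 1 \<le> a \<and> a < b \<and> b \<le> m} \<union> (\<lambda>a. (a, Suc m)) ` {1..m}" by auto
  have "finite {(a, b). 1 \<le> a \<and> a < b \<and> b \<le> m}"
    by (rule finite_subset[of _ "{..m} \<times> {..m}"]) auto
  then have "card {(a, b). 1 \<le> a \<and> a < b \<and> b \<le> Suc m} = (m choose 2) + card ((\<lambda>a. (a, Suc m)) ` {1..m})"
    unfolding eq using Suc by (subst card_Un_disjoint) auto
  also have "card ((\<lambda>a. (a, Suc m)) ` {1..m}) = m"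
    by (subst card_image) (auto simp: inj_on_def)
  finally show ?case by (simp add: choose_two_Suc)
qed

text \<open>
Two kinds of connected sets are exhibited: intervals of a single path that avoid the clique,
and unions of initial pieces of the paths, not all empty. The latter are connected through the clique.
\<close>

lemma num_conn_clique_paths_ge:
  assumes pos: "\<forall>m\<in>set ns. m \<ge> 1"
  shows "clique_paths_count (mset ns) \<le> num_conn (parcs (clique_paths ns)) (pverts (clique_paths ns))"
proof -
  let ?E = "parcs (clique_paths ns)" and ?V = "pverts (clique_paths ns)"
  let ?q = "length ns"
  interpret pair_graph "clique_paths ns" using pair_graph_clique_paths[OF pos] .
  have sE: "sym ?E" using sym_arcs by (simp add: symmetric_def)
  have pos': "0 < ns ! j" if "j < ?q" for j using pos nth_mem[OF that] by fastforce
  have step: "((j, i), (j, Suc i)) \<in> ?E" if "j < ?q" "Suc i < ns ! j" for i j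
    using that by (auto simp: clique_paths_def)
  have clique: "((j, 0), (k, 0)) \<in> ?E" if "j < ?q" "k < ?q" "j \<noteq> k" for j k
    using that by (auto simp: clique_paths_def)
  have conn_seg: "conn ?E (Pair j ` {a..<b})" if "j < ?q" "a < b" "b \<le> ns ! j" for j a b
    by (rule conn_path[OF sE that(2)]) (use step that in auto)
  \<comment> \<open>\<open>Fs\<close> lists the lengths of the initial pieces, \<open>Is\<close> the path and
    the ends of the interval.\<close>
  define Fs where "Fs = (\<Pi>\<^sub>E j\<in>{..<?q}. {..ns ! j}) - {\<lambda>j\<in>{..<?q}. 0}"
  define hub where "hub = (\<lambda>f. SIGMA j:{..<?q}. {..<f j :: nat})"
  define Is where "Is = (SIGMA j:{..<?q}. {(a, b). 1 \<le> a \<and> a < b \<and> b \<le> ns ! j})"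
  define seg where "seg = (\<lambda>(j :: nat, a :: nat, b). Pair j ` {a..<b})"
  let ?C = "{S. S \<subseteq> ?V \<and> conn ?E S}"
  have "hub f \<in> ?C" "\<exists>j. (j, 0) \<in> hub f" if f: "f \<in> Fs" for f
  proof -
    have fE: "f \<in> (\<Pi>\<^sub>E j\<in>{..<?q}. {..ns ! j})" "f \<noteq> (\<lambda>j\<in>{..<?q}. 0)" using f by (auto simp: Fs_def)
    obtain j where j: "j < ?q" "f j > 0"
    proof (rule ccontr)
      assume "\<not> thesis"
      then have "\<forall>j<?q. f j = 0" using that by blast
      then have "f = (\<lambda>j\<in>{..<?q}. 0)" using fE(1) by (auto simp: fun_eq_iff PiE_def extensional_def)
      then show False using fE(2) by simp
    qed
    have le: "f k \<le> ns ! k" if "k < ?q" for k using fE(1) that by (auto simp: PiE_iff)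
    have "hub f \<subseteq> ?V" using le by (fastforce simp: hub_def clique_paths_def)
    moreover have "conn ?E (hub f)"
    proof (rule conn_fromI[OF sE, of "(j, 0)"])
      show "(j, 0) \<in> hub f" using j by (simp add: hub_def)
      fix y assume "y \<in> hub f"
      then obtain k i where y: "y = (k, i)" "k < ?q" "i < f k" by (auto simp: hub_def)
      have sub: "Pair k ` {0..<f k} \<subseteq> hub f" using y by (auto simp: hub_def)
      have "conn ?E (Pair k ` {0..<f k})" using conn_seg[of k 0 "f k"] y le by auto
      then have "((k, 0), y) \<in> (Restr ?E (Pair k ` {0..<f k}))\<^sup>*" using y by (auto intro: connD)
      then have 1: "((k, 0), y) \<in> (Restr ?E (hub f))\<^sup>*" using sub by (auto elim: rtrancl_Restr_mono)
      have "((j, 0), (k, 0)) \<in> (Restr ?E (hub f))\<^sup>*"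
      proof (cases "j = k")
        case False
        then have "((j, 0), (k, 0)) \<in> Restr ?E (hub f)" using clique j y by (auto simp: hub_def)
        then show ?thesis by auto
      qed simp
      then show "((j, 0), y) \<in> (Restr ?E (hub f))\<^sup>*" using 1 by (rule rtrancl_trans)
    qed
    ultimately show "hub f \<in> ?C" by simp
    show "\<exists>j. (j, 0) \<in> hub f" using j by (auto simp: hub_def)
  qed
  moreover have "seg x \<in> ?C" "\<not> (\<exists>j. (j, 0) \<in> seg x)" if "x \<in> Is" for x
    using that conn_seg by (auto simp: Is_def seg_def) (auto simp: clique_paths_def)
  ultimately have sub: "hub ` Fs \<union> seg ` Is \<subseteq> ?C" and disj: "hub ` Fs \<inter> seg ` Is = {}" by blast+
  have inj_hub: "inj_on hub Fs"
  proof (rule inj_onI)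
    fix f g assume f: "f \<in> Fs" and g: "g \<in> Fs" and eq: "hub f = hub g"
    have "f j = g j" if "j < ?q" for j
    proof -
      have "{i. (j, i) \<in> hub f} = {i. (j, i) \<in> hub g}" using eq by simp
      then have "{..<f j} = {..<g j}" using that by (simp add: hub_def lessThan_def)
      then show ?thesis by simp
    qed
    then show "f = g" using f g by (auto simp: Fs_def fun_eq_iff PiE_def extensional_def) metis
  qed
  have inj_seg: "inj_on seg Is"
  proof (rule inj_onI)
    fix y z assume yz: "y \<in> Is" "z \<in> Is" "seg y = seg z"
    obtain j a b j' a' b' where y: "y = (j, a, b)" and z: "z = (j', a', b')"
      using prod_cases3 by metis
    have x: "(j, a, b) \<in> Is" "(j', a', b') \<in> Is" and eq: "seg (j, a, b) = seg (j', a', b')"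
      using yz by (simp_all add: y z)
    have ab: "a < b" "a' < b'" using x by (auto simp: Is_def)
    have "(j, a) \<in> seg (j', a', b')" using ab unfolding eq[symmetric] by (simp add: seg_def)
    then have j: "j = j'" by (auto simp: seg_def)
    then have "{a..<b} = {a'..<b'}" using eq by (auto simp: seg_def inj_image_eq_iff inj_on_def)
    then show "y = z" using ab j by (simp add: y z atLeastLessThan_eq_iff)
  qed
  have finFs: "finite Fs" by (auto simp: Fs_def intro!: finite_PiE)
  have fin_pairs: "finite {(a, b). 1 \<le> a \<and> a < b \<and> b \<le> m}" for m :: nat
    by (rule finite_subset[of _ "{..m} \<times> {..m}"]) auto
  have "card Fs = (\<Prod>j<?q. Suc (ns ! j)) - 1"
    unfolding Fs_def by (subst card_Diff_subset) (auto simp: card_PiE)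
  also have "(\<Prod>j<?q. Suc (ns ! j)) = (\<Prod>n\<leftarrow>ns. Suc n)"
    by (simp add: prod.list_conv_set_nth atLeast0LessThan)
  finally have cFs: "card Fs = (\<Prod>n\<leftarrow>ns. Suc n) - 1" .
  have cIs: "card Is = (\<Sum>n\<leftarrow>ns. n choose 2)"
    unfolding Is_def using fin_pairs
    by (subst card_SigmaI) (auto simp: card_increasing_pairs[simplified] sum.list_conv_set_nth atLeast0LessThan)
  have "clique_paths_count (mset ns) = card Is + card Fs"
    using prod_list_Suc_pos[of "\<lambda>n. n" ns] by (simp add: clique_paths_count_mset cIs cFs)
  also have "\<dots> = card (hub ` Fs \<union> seg ` Is)"
    using disj inj_hub inj_seg finFs fin_pairs
    by (subst card_Un_disjoint) (auto simp: card_image Is_def)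
  also have "\<dots> \<le> card ?C"
    using sub pair_finite_verts by (intro card_mono) auto
  finally show ?thesis unfolding num_conn_def .
qed

section \<open>Adjacent vertices in a broom\<close>

text \<open>
From here on the families of regions are handled through the lemmas about membership below.
\<close>

declare joins.simps(2) [simp del]

abbreviation regions :: "'a rtree \<Rightarrow> 'a set set" where
  "regions t \<equiv> top_regions t \<union> deep_regions t"

lemma singleton_top_region: "{x} \<in> top_regions (Node x ts)"
  using imageI[OF empty_in_joins[of "map top_regions ts"], of "insert x"] by simp

lemma empty_notin_top_regions: "{} \<notin> top_regions t"
  by (cases t) auto

text \<open>
Nothing needs to be chosen from the other children.
\<close>

lemma top_region_of_child_in_joins: "t \<in> set ts \<Longrightarrow> X \<in> top_regions t \<Longrightarrow> X \<in> joins (map top_regions ts)"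
proof (induction ts)
  case (Cons s ts)
  then consider "X \<in> top_regions s" | "X \<in> joins (map top_regions ts)" by auto
  then show ?case
  proof cases
    case 1
    then show ?thesis using joins_ConsI[of X "top_regions s" "{}" "map top_regions ts"] by simp
  next
    case 2
    then show ?thesis using joins_ConsI[of "{}" "top_regions s" X "map top_regions ts"] by simp
  qed
qed simp

lemma top_regions_of_children_in_joins:
  assumes "s \<in> set ts" "t \<in> set ts" "s \<noteq> t" "X \<in> top_regions s" "Y \<in> top_regions t"
  shows "X \<union> Y \<in> joins (map top_regions ts)"
  using assms(1,2)
proof (induction ts)
  case (Cons u ts)
  consider "s = u" "t \<in> set ts" | "t = u" "s \<in> set ts" | "s \<in> set ts" "t \<in> set ts"
    using Cons.prems assms(3) by auto
  then show ?case
  proof cases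
    case 1
    then show ?thesis
      using joins_ConsI[of X "top_regions u" Y "map top_regions ts"] top_region_of_child_in_joins[OF 1(2) assms(5)] assms(4) by simp
  next
    case 2
    then show ?thesis
      using joins_ConsI[of Y "top_regions u" X "map top_regions ts"] top_region_of_child_in_joins[OF 2(2) assms(4)] assms(5)
      by (simp add: Un_commute)
  next
    case 3
    then show ?thesis
      using joins_ConsI[of "{}" "top_regions u" "X \<union> Y" "map top_regions ts"] Cons.IH by simp
  qed
qed simp

lemma regions_child: "t \<in> set ts \<Longrightarrow> regions t \<subseteq> regions (Node x ts)"
  using top_region_of_child_in_joins[of t ts] empty_notin_top_regions[of t] by auto

lemma parent_child_region: "Node y us \<in> set ts \<Longrightarrow> {x, y} \<in> regions (Node x ts)"
  using imageI[OF top_region_of_child_in_joins[OF _ singleton_top_region], of y us ts "insert x"] by simp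

declare top_regions.simps [simp del] deep_regions.simps [simp del]

lemma regions_stalk: "regions t \<subseteq> regions (stalk xs t)"
proof (induction xs)
  case (Cons x xs)
  have "regions (stalk xs t) \<subseteq> regions (stalk (x # xs) t)"
    unfolding stalk_simps by (rule regions_child) simp
  with Cons.IH show ?case by (rule subset_trans)
qed simp

lemma stalk_consecutive_region:
  "Suc i < length (xs @ [v]) \<Longrightarrow> {(xs @ [v]) ! i, (xs @ [v]) ! Suc i} \<in> regions (stalk xs (Node v ts))"
proof (induction xs arbitrary: i)
  case (Cons x xs)
  show ?case
  proof (cases i)
    case 0
    obtain us where "stalk xs (Node v ts) = Node ((xs @ [v]) ! 0) us"
      by (cases xs) auto
    then show ?thesis using parent_child_region[of "(xs @ [v]) ! 0" us "[stalk xs (Node v ts)]" x] 0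
      by simp
  next
    case (Suc j)
    then have "{(xs @ [v]) ! j, (xs @ [v]) ! Suc j} \<in> regions (stalk xs (Node v ts))"
      using Cons by simp
    then show ?thesis using regions_child[of "stalk xs (Node v ts)" "[stalk xs (Node v ts)]" x] Suc
      by auto
  qed
qed simp

text \<open>
Consecutive vertices are parent and child. The upper path is reversed because it is read from the
hub outwards, like the bristles.
\<close>

lemma broom_path_region:
  assumes "[] \<notin> set ls" "l \<in> set (rev (xs @ [v]) # ls)" "Suc i < length l"
  shows "{l ! i, l ! Suc i} \<in> regions (broom xs v ls)"
proof (cases "l \<in> set ls")
  case True
  let ?p = "stalk (butlast l) (Node (last l) [])"
  have "l \<noteq> []" using assms(3) by auto
  then have "{l ! i, l ! Suc i} \<in> regions ?p"
    using stalk_consecutive_region[of i "butlast l" "last l" "[]"] assms(3) by simp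
  then have "{l ! i, l ! Suc i} \<in> regions (Node v (map (\<lambda>l. stalk (butlast l) (Node (last l) [])) ls))"
    using regions_child[of ?p "map (\<lambda>l. stalk (butlast l) (Node (last l) [])) ls" v] True by auto
  then show ?thesis unfolding broom_def by (rule subsetD[OF regions_stalk])
next
  case False
  let ?zs = "xs @ [v]"
  have l: "l = rev ?zs" using False assms(2) by auto
  define j where "j = length ?zs - Suc (Suc i)"
  have j: "Suc j < length ?zs" "l ! i = ?zs ! Suc j" "l ! Suc i = ?zs ! j"
    using assms(3) by (simp_all only: l length_rev rev_nth j_def) (auto simp: Suc_diff_Suc)
  show ?thesis
    using stalk_consecutive_region[OF j(1)] unfolding broom_def j(2,3) by (simp only: insert_commute)
qed

text \<open>
The heads of the bristles are children of \<open>v\<close>, and \<open>v\<close> is the head of the upper path. Parent and child,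
or two siblings, form a region.
\<close>

lemma broom_hub_region:
  assumes "[] \<notin> set ls" "l \<in> set (rev (xs @ [v]) # ls)" "l' \<in> set (rev (xs @ [v]) # ls)" "hd l \<noteq> hd l'"
  shows "{hd l, hd l'} \<in> regions (broom xs v ls)"
proof -
  define p where "p = (\<lambda>l :: 'a list. stalk (butlast l) (Node (last l) []))"
  have b: "broom xs v ls = stalk xs (Node v (map p ls))" by (simp add: broom_def p_def)
  have p: "\<exists>us. p l = Node (hd l) us" if l: "l \<in> set ls" for l
  proof -
    have "l \<noteq> []" using l assms(1) by auto
    then show ?thesis by (cases l; cases "tl l") (auto simp: p_def)
  qed
  have vl: "{v, hd l} \<in> regions (broom xs v ls)" if l: "l \<in> set ls" for l
  proof -
    obtain us where "p l = Node (hd l) us" using p[OF l] by blast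
    then have "Node (hd l) us \<in> set (map p ls)" using l by (metis image_eqI list.set_map)
    then show ?thesis unfolding b by (rule subsetD[OF regions_stalk parent_child_region])
  qed
  have hds: "l = rev (xs @ [v]) \<Longrightarrow> hd l = v" for l by simp
  consider "l \<in> set ls" "l' \<in> set ls" | "hd l = v" "l' \<in> set ls" | "l \<in> set ls" "hd l' = v"
    using assms hds by auto
  then show ?thesis
  proof cases
    case 1
    obtain us us' where us: "p l = Node (hd l) us" "p l' = Node (hd l') us'" using p 1 by blast
    have "{hd l} \<union> {hd l'} \<in> joins (map top_regions (map p ls))"
    proof (rule top_regions_of_children_in_joins[of "p l" _ "p l'"])
      show "p l \<in> set (map p ls)" "p l' \<in> set (map p ls)" using 1 by simp_all
      show "p l \<noteq> p l'" using us assms(4) by simp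
    qed (simp_all add: us singleton_top_region)
    then have "{hd l, hd l'} \<in> joins (map top_regions (map p ls))"
      by (simp only: Un_insert_left Un_empty_left)
    then have "{hd l, hd l'} \<in> regions (Node v (map p ls))"
      by (simp only: deep_regions.simps Un_iff Diff_iff) simp
    then show ?thesis unfolding b by (rule subsetD[OF regions_stalk])
  next
    case 2
    then show ?thesis using vl by simp
  next
    case 3
    then show ?thesis using vl by (simp add: insert_commute)
  qed
qed

lemma broom_path:
  "broom xs v [] = stalk xs (Node v [])"
  "l \<noteq> [] \<Longrightarrow> broom xs v [l] = stalk (butlast (xs @ v # l)) (Node (last (xs @ v # l)) [])"
  by (simp_all add: broom_def stalk_append butlast_append)

section \<open>The extremal graphs\<close>

lemma digraph_isoI:
  assumes H: "pair_graph H" and G: "pair_graph G" and bij: "bij_betw f (pverts G) (pverts H)"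
    and edges: "\<And>p q. p \<in> pverts G \<Longrightarrow> q \<in> pverts G \<Longrightarrow> (p, q) \<in> parcs G \<longleftrightarrow> (f p, f q) \<in> parcs H"
  shows "digraph_iso (with_proj H) (with_proj G)"
proof -
  interpret H: pair_graph H by fact
  interpret G: pair_graph G by fact
  define g where "g = the_inv_into (pverts G) f"
  have g: "bij_betw g (pverts H) (pverts G)" unfolding g_def using bij by (rule bij_betw_the_inv_into)
  have gf: "g (f p) = p" if "p \<in> pverts G" for p
    using that bij by (simp add: g_def bij_betw_def the_inv_into_f_f)
  have fg: "f (g x) = x" if "x \<in> pverts H" for x
    using that bij by (simp add: g_def bij_betw_def f_the_inv_into_f)
  have gH: "g x \<in> pverts G" if "x \<in> pverts H" for x using g that by (auto simp: bij_betw_def)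
  have fG: "f p \<in> pverts H" if "p \<in> pverts G" for p using bij that by (auto simp: bij_betw_def)
  define i where "i = \<lparr> iso_verts = g, iso_arcs = map_prod g g, iso_head = snd, iso_tail = fst \<rparr>"
  have "inj_on (map_prod g g) (parcs H)"
  proof (rule inj_onI)
    fix e e' assume e: "e \<in> parcs H" "e' \<in> parcs H" "map_prod g g e = map_prod g g e'"
    then have "g (fst e) = g (fst e')" "g (snd e) = g (snd e')"
      by (metis fst_map_prod) (metis e(3) snd_map_prod)
    then show "e = e'"
      using g e(1,2) H.arc_fst_in_verts H.arc_snd_in_verts by (metis bij_betw_def inj_onD prod_eqI)
  qed
  then have iso: "pre_digraph.digraph_isomorphism (with_proj H) i"
    using g by (auto simp: pre_digraph.digraph_isomorphism_def i_def bij_betw_def wf_digraph_wp_iff H.pair_wf_digraph)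
  have "map_prod g g ` parcs H = parcs G"
  proof (intro equalityI image_subsetI subrelI)
    fix e assume e: "e \<in> parcs H"
    obtain x y where xy: "e = (x, y)" by (cases e)
    then have "x \<in> pverts H" "y \<in> pverts H" using e by (auto dest: H.wellformed')
    then show "map_prod g g e \<in> parcs G" using edges[of "g x" "g y"] fg gH e xy by simp
  next
    fix p q assume pq: "(p, q) \<in> parcs G"
    then have "p \<in> pverts G" "q \<in> pverts G" by (auto dest: G.wellformed')
    then have "(f p, f q) \<in> parcs H" "(p, q) = map_prod g g (f p, f q)" using edges pq gf by auto
    then show "(p, q) \<in> map_prod g g ` parcs H" by (metis imageI)
  qed
  then have "with_proj G = app_iso i (with_proj H)"
    using g by (simp add: app_iso_def i_def with_proj_def bij_betw_def)
  then show ?thesis using iso unfolding digraph_iso_def by blast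
qed

text \<open>
The inverse of the isomorphism embeds \<open>G\<close> into \<open>H\<close>.
\<close>

lemma num_conn_digraph_iso:
  assumes H: "pair_graph H" and G: "pair_graph G" and iso: "digraph_iso (with_proj H) (with_proj G)"
  shows "num_conn (parcs G) (pverts G) \<le> num_conn (parcs H) (pverts H)"
proof -
  interpret H: pair_graph H by fact
  interpret G: pair_graph G by fact
  obtain i where i: "pre_digraph.digraph_isomorphism (with_proj H) i" "with_proj G = app_iso i (with_proj H)"
    using iso by (auto simp: digraph_iso_def)
  define g where "g = iso_verts i"
  define f where "f = the_inv_into (pverts H) g"
  have inj: "inj_on g (pverts H)" using i(1) by (simp add: pre_digraph.digraph_isomorphism_def g_def)
  have G_eq: "pverts G = g ` pverts H" "parcs G = iso_arcs i ` parcs H" "iso_tail i = fst" "iso_head i = snd"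
    using i(2) by (simp_all add: app_iso_def with_proj_def g_def)
  have fg: "f (g x) = x" if "x \<in> pverts H" for x
    using inj that by (simp add: f_def the_inv_into_f_f)
  have "(f p, f q) \<in> parcs H" if pq: "(p, q) \<in> parcs G" for p q
  proof -
    obtain e where e: "e \<in> parcs H" "(p, q) = iso_arcs i e" using pq G_eq(2) by auto
    have "g (fst e) = fst (iso_arcs i e)" "g (snd e) = snd (iso_arcs i e)"
      using i(1) e(1) G_eq(3,4) by (auto simp: pre_digraph.digraph_isomorphism_def g_def)
    then have "p = g (fst e)" "q = g (snd e)" using e(2) by (metis fst_conv, metis snd_conv)
    then show ?thesis
      using e(1) fg H.arc_fst_in_verts[OF e(1)] H.arc_snd_in_verts[OF e(1)] by simp
  qed
  moreover have "inj_on f (pverts G)" "f ` pverts G \<subseteq> pverts H"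
    using fg by (auto simp: G_eq(1) inj_on_def)
  ultimately show ?thesis using H.pair_finite_verts by (intro num_conn_embed(1)[of _ f]) auto
qed

text \<open>
The tree covering a graph, replaced by a broom that has at least as many regions. In the case of
equality of the final counts, nothing was lost: the tree is the broom, and every region is connected.
\<close>

lemma conn_regions_broom:
  assumes E: "sym E" "finite V" "conn E V" and k: "card {v \<in> V. conn E (V - {v})} = k" "k \<ge> 2"
  obtains xs v ls where
    "[] \<notin> set ls" "Suc (length ls) = k" "mset (concat (rev (xs @ [v]) # ls)) = mset_set V"
    "num_conn E V \<le> clique_paths_count (mset (Suc (length xs) # map length ls))"
    "num_conn E V = clique_paths_count (mset (Suc (length xs) # map length ls)) \<longrightarrow>
      {S. S \<subseteq> V \<and> conn E S} = regions (broom xs v ls)"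
proof -
  let ?N = "{v \<in> V. conn E (V - {v})}" and ?F = "{S. S \<subseteq> V \<and> conn E S}"
  have finN: "finite ?N" using E(2) by simp
  have "?N \<noteq> {}" using k by (metis card.empty not_numeral_le_zero)
  then obtain r where r: "r \<in> ?N" by blast
  have N_r: "{v \<in> V - {r}. conn E (V - {v})} = ?N - {r}" by blast
  have "V \<noteq> {r}" using conn_nonempty[of E "V - {r}"] r by auto
  obtain t where cover: "tree_cover E V r t"
    using tree_cover_exists[OF E(1,2,3), of r] r by auto
  have labels_t: "labels t = mset_set V" using cover by (simp add: tree_cover_def)
  have "leaves t = mset_set (?N - {r})"
    using cover \<open>V \<noteq> {r}\<close> unfolding tree_cover_def N_r by simp
  then have leaves_t: "size (leaves t) = k - 1" using r k(1) finN by simp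
  have "S \<in> regions t" if "S \<subseteq> V" "conn E S" for S
    using cover that unfolding tree_cover_def by (metis UnCI)
  then have sub: "?F \<subseteq> regions t" by auto
  have fin: "finite (regions t)" and le_t: "card (regions t) \<le> num_top t + num_deep t"
    using card_top_regions[of t] card_deep_regions[of t] card_Un_le[of "top_regions t" "deep_regions t"] by auto
  obtain xs v ls where b: "[] \<notin> set ls" "labels (broom xs v ls) = labels t" "leaves (broom xs v ls) = leaves t"
    "num_top t + num_deep t \<le> num_top (broom xs v ls) + num_deep (broom xs v ls)"
    "num_top t + num_deep t = num_top (broom xs v ls) + num_deep (broom xs v ls) \<Longrightarrow> t = broom xs v ls"
    using broom_maximises[of t] by (elim exE conjE) blast
  \<comment> \<open>A broom without bristles is a path. Its last vertex is split off as a bristle, so that the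
    number of paths is always \<open>k\<close>.\<close>
  have "\<exists>xs' v' ls'. broom xs' v' ls' = broom xs v ls \<and> [] \<notin> set ls' \<and> ls' \<noteq> []"
  proof (cases "ls = []")
    case True
    have "card V \<ge> 2" using card_mono[OF E(2), of ?N] k by auto
    moreover have "size (labels (broom xs v ls)) = card V" using b(2) labels_t by simp
    ultimately have "xs \<noteq> []" using labels_broom[OF b(1), of xs v] True by auto
    then have "broom (butlast xs) (last xs) [[v]] = broom xs v ls"
      using True broom_path(2)[of "[v]" "butlast xs" "last xs"] by (simp add: broom_path(1) butlast_append)
    then show ?thesis by (intro exI[of _ "butlast xs"] exI[of _ "last xs"] exI[of _ "[[v]]"]) simp
  qed (use b(1) in blast)
  then obtain xs' v' ls' where b': "broom xs' v' ls' = broom xs v ls" "[] \<notin> set ls'" "ls' \<noteq> []" by blast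
  have tot: "num_top (broom xs v ls) + num_deep (broom xs v ls)
      = clique_paths_count (mset (Suc (length xs') # map length ls'))"
    using total_broom[OF b'(2), of xs' v'] b'(1) by simp
  show thesis
  proof (rule that)
    show "[] \<notin> set ls'" by fact
    show "Suc (length ls') = k"
      using leaves_broom[of xs' v' ls'] b' b(3) leaves_t k(2) by (metis One_nat_def Suc_diff_1 Suc_le_lessD length_map less_le_trans pos2 size_mset)
    show "mset (concat (rev (xs' @ [v']) # ls')) = mset_set V"
      using labels_broom[OF b'(2), of xs' v'] b'(1) b(2) labels_t by simp
    have "num_conn E V \<le> card (regions t)" unfolding num_conn_def using fin sub by (rule card_mono)
    then show "num_conn E V \<le> clique_paths_count (mset (Suc (length xs') # map length ls'))"
      using le_t b(4) tot by simp
    show "num_conn E V = clique_paths_count (mset (Suc (length xs') # map length ls')) \<longrightarrow>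
      ?F = regions (broom xs' v' ls')"
    proof
      assume eq: "num_conn E V = clique_paths_count (mset (Suc (length xs') # map length ls'))"
      then have "num_top t + num_deep t = num_top (broom xs v ls) + num_deep (broom xs v ls)"
        using \<open>num_conn E V \<le> card (regions t)\<close> le_t b(4) tot by simp
      then have "t = broom xs' v' ls'" using b(5) b'(1) by simp
      moreover have "card ?F = card (regions t)"
        using eq \<open>num_conn E V \<le> card (regions t)\<close> le_t b(4) tot unfolding num_conn_def by simp
      then have "?F = regions t" using sub fin by (intro card_subset_eq)
      ultimately show "?F = regions (broom xs' v' ls')" by simp
    qed
  qed
qed

text \<open>
With a single bristle the broom is one path, and the vertex called its hub is arbitrary.
\<close>

lemma broom_resplit:
  assumes "l \<noteq> []" "0 < i" "i \<le> length (xs @ [v]) + length l - 1"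
  obtains xs' v' l' where "l' \<noteq> []" "broom xs' v' [l'] = broom xs v [l]" "xs' @ v' # l' = xs @ v # l"
    "Suc (length xs') = i"
proof -
  let ?zs = "xs @ v # l"
  have len: "i < length ?zs" using assms by (cases l) auto
  define xs' where "xs' = take (i - 1) ?zs"
  define v' where "v' = ?zs ! (i - 1)"
  define l' where "l' = drop i ?zs"
  have "?zs = take (i - 1) ?zs @ ?zs ! (i - 1) # drop (Suc (i - 1)) ?zs"
    by (rule id_take_nth_drop) (use len in simp)
  then have zs: "xs' @ v' # l' = ?zs" using assms(2) by (simp add: xs'_def v'_def l'_def)
  moreover have "l' \<noteq> []" unfolding l'_def drop_eq_Nil using len by simp
  moreover have "Suc (length xs') = i" using len assms(2) by (simp add: xs'_def)
  moreover have "broom xs' v' [l'] = broom xs v [l]"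
    unfolding broom_path(2)[OF \<open>l' \<noteq> []\<close>] broom_path(2)[OF assms(1)] zs ..
  ultimately show thesis using that by blast
qed

text \<open>
The edges supplied by \<open>path\<close> and \<open>hub\<close> embed \<open>G(n\<^sub>1; \<dots>; n\<^sub>k)\<close> in \<open>H\<close> as a spanning subgraph. Any further
edge of \<open>H\<close> would push the number of connected sets above the bound \<open>max\<close>.
\<close>

lemma iso_clique_pathsI:
  assumes H: "pair_graph H" and L: "[] \<notin> set L" "mset (concat L) = mset_set (pverts H)"
    and path: "\<And>l i. l \<in> set L \<Longrightarrow> Suc i < length l \<Longrightarrow> conn (parcs H) {l ! i, l ! Suc i}"
    and hub: "\<And>l l'. l \<in> set L \<Longrightarrow> l' \<in> set L \<Longrightarrow> hd l \<noteq> hd l' \<Longrightarrow> conn (parcs H) {hd l, hd l'}"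
    and max: "num_conn (parcs H) (pverts H) \<le> clique_paths_count (mset (map length L))"
  shows "digraph_iso (with_proj H) (with_proj (clique_paths (map length L)))"
proof -
  let ?G = "clique_paths (map length L)"
  define f where "f = (\<lambda>(j, i). L ! j ! i)"
  have pos: "\<forall>m\<in>set (map length L). m \<ge> 1" using L(1) by (auto simp: Suc_le_eq)
  note G = pair_graph_clique_paths[OF pos]
  interpret H: pair_graph H by fact
  interpret G: pair_graph ?G by fact
  have sH: "sym (parcs H)" using H.sym_arcs by (simp add: symmetric_def)
  have VG: "pverts ?G = (SIGMA j:{..<length L}. {..<length (L ! j)})"
    by (auto simp: clique_paths_def)
  have V: "pverts H = (\<Union>l\<in>set L. set l)"
    using L(2) H.pair_finite_verts by (metis finite_set_mset_mset_set set_concat set_mset_mset)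
  have surj: "f ` pverts ?G = pverts H"
    unfolding V VG f_def by (force simp: in_set_conv_nth)
  \<comment> \<open>The map \<open>f\<close> is onto and both vertex sets have the same size, so it is
    injective.\<close>
  have "card (pverts H) = size (mset (concat L))" using L(2) by simp
  also have "\<dots> = (\<Sum>j<length L. length (L ! j))"
    by (simp add: length_concat sum.list_conv_set_nth atLeast0LessThan)
  also have "\<dots> = card (pverts ?G)" unfolding VG by simp
  finally have "card (f ` pverts ?G) = card (pverts ?G)" using surj by simp
  then have inj: "inj_on f (pverts ?G)" by (rule eq_card_imp_inj_on[OF G.pair_finite_verts])
  have edges: "(f p, f q) \<in> parcs H" if e: "(p, q) \<in> parcs ?G" for p q
  proof -
    have pq: "p \<in> pverts ?G" "q \<in> pverts ?G" "p \<noteq> q"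
      using e G.wellformed' G.no_loops' by blast+
    then have ne: "f p \<noteq> f q" using inj by (auto dest: inj_onD)
    consider j k where "p = (j, 0)" "q = (k, 0)" "j < length L" "k < length L"
      | j i where "p = (j, i)" "q = (j, Suc i)" "j < length L" "Suc i < length (L ! j)"
      | j i where "p = (j, Suc i)" "q = (j, i)" "j < length L" "Suc i < length (L ! j)"
      using e by (auto simp: clique_paths_def)
    then have "conn (parcs H) {f p, f q}"
    proof cases
      case 1
      then have "f p = hd (L ! j)" "f q = hd (L ! k)"
        using L(1) by (auto simp: f_def hd_conv_nth) (metis hd_conv_nth nth_mem)+
      then show ?thesis using hub[of "L ! j" "L ! k"] 1 ne by simp
    next
      case 2
      then show ?thesis using path[of "L ! j" i] by (simp add: f_def)
    next
      case 3
      then show ?thesis using path[of "L ! j" i] by (simp add: f_def insert_commute)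
    qed
    then show ?thesis using ne by (rule conn_pairD)
  qed
  show ?thesis
  proof (rule digraph_isoI[OF H G])
    show "bij_betw f (pverts ?G) (pverts H)" using inj surj by (simp add: bij_betw_def)
    fix p q assume pq: "p \<in> pverts ?G" "q \<in> pverts ?G"
    show "(p, q) \<in> parcs ?G \<longleftrightarrow> (f p, f q) \<in> parcs H"
    proof
      assume e: "(f p, f q) \<in> parcs H"
      then have "p \<noteq> q" using H.no_loops' by blast
      show "(p, q) \<in> parcs ?G"
      proof (rule ccontr)
        assume "(p, q) \<notin> parcs ?G"
        then have "num_conn (parcs ?G) (pverts ?G) < num_conn (parcs H) (pverts H)"
          using H.pair_finite_verts inj surj edges sH pq \<open>p \<noteq> q\<close> e by (intro num_conn_embed(2)[of _ f]) auto
        then show False using num_conn_clique_paths_ge[OF pos] max by simp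
      qed
    qed (rule edges)
  qed
qed

lemma connected_induced_bound:
  assumes H: "pair_graph H" "conn (parcs H) (pverts H)" and n: "card (pverts H) = n"
    and k: "card {v \<in> pverts H. conn (parcs H) (pverts H - {v})} = k" "k \<ge> 2"
  defines "ns \<equiv> replicate (k - n mod k) (n div k) @ replicate (n mod k) (n div k + 1)"
  shows "num_conn (parcs H) (pverts H) \<le> clique_paths_count (mset ns) \<and>
    (num_conn (parcs H) (pverts H) = clique_paths_count (mset ns) \<longleftrightarrow>
      digraph_iso (with_proj H) (with_proj (clique_paths ns)))"
proof -
  let ?N = "num_conn (parcs H) (pverts H)"
  interpret pair_graph H by fact
  have sE: "sym (parcs H)" using sym_arcs by (simp add: symmetric_def)
  have ns: "mset ns = balanced n k" by (simp add: ns_def balanced_def)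
  obtain xs v ls where b: "[] \<notin> set ls" "Suc (length ls) = k"
    "mset (concat (rev (xs @ [v]) # ls)) = mset_set (pverts H)"
    "?N \<le> clique_paths_count (mset (Suc (length xs) # map length ls))"
    "?N = clique_paths_count (mset (Suc (length xs) # map length ls)) \<longrightarrow>
      {S. S \<subseteq> pverts H \<and> conn (parcs H) S} = regions (broom xs v ls)"
    by (rule conn_regions_broom[OF sE pair_finite_verts H(2) k])
  define M where "M = mset (Suc (length xs) # map length ls)"
  have "size (mset (concat (rev (xs @ [v]) # ls))) = n" using b(3) n by simp
  then have sum: "sum_mset M = n" unfolding M_def sum_mset_sum_list by (simp add: length_concat)
  have size: "size M = k" using b(2) by (simp add: M_def)
  have M0: "M \<noteq> {#}" "0 \<notin># M" using b(1) by (auto simp: M_def)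
  have le: "clique_paths_count M \<le> clique_paths_count (balanced n k)"
    and eq: "k \<ge> 3 \<Longrightarrow> clique_paths_count M = clique_paths_count (balanced n k) \<Longrightarrow> M = balanced n k"
    using clique_paths_count_le_balanced[OF M0] unfolding sum size by auto
  have kn: "k \<le> n" using card_mono[OF pair_finite_verts, of "{v \<in> pverts H. conn (parcs H) (pverts H - {v})}"] n k by auto
  then have s: "n div k \<ge> 1" using k(2) by (simp add: Suc_le_eq div_greater_zero_iff)
  have bound: "?N \<le> clique_paths_count (mset ns)" using b(4) le unfolding M_def[symmetric] ns by simp
  have "digraph_iso (with_proj H) (with_proj (clique_paths ns))" if N: "?N = clique_paths_count (mset ns)"
  proof -
    have NM: "?N = clique_paths_count M" "clique_paths_count M = clique_paths_count (balanced n k)"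
      using N b(4) le unfolding M_def[symmetric] ns by simp_all
    have F: "{S. S \<subseteq> pverts H \<and> conn (parcs H) S} = regions (broom xs v ls)"
      using b(5) NM(1) unfolding M_def by simp
    \<comment> \<open>Three or more path lengths are forced to be balanced. Two of them are not, but their
      common path can be cut anew at its \<open>n div 2\<close>-th vertex.\<close>
    have "\<exists>xs' v' ls'. broom xs' v' ls' = broom xs v ls \<and> [] \<notin> set ls' \<and>
      mset (concat (rev (xs' @ [v']) # ls')) = mset_set (pverts H) \<and>
      mset (Suc (length xs') # map length ls') = balanced n k"
    proof (cases "k = 2")
      case False
      then show ?thesis
        using eq NM(2) k(2) b(1,3) M_def by (intro exI[of _ xs] exI[of _ v] exI[of _ ls]) simp
    next
      case True
      then obtain l where l: "ls = [l]" using b(2) by (auto simp: length_Suc_conv)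
      have nl: "n = Suc (length xs) + length l" using sum by (simp add: M_def l)
      obtain xs' v' l' where l': "l' \<noteq> []" "broom xs' v' [l'] = broom xs v [l]"
        "xs' @ v' # l' = xs @ v # l" "Suc (length xs') = n div 2"
        by (rule broom_resplit[of l "n div 2" xs v]) (use b(1) l s True nl in auto)
      have "length (xs' @ v' # l') = n" using nl l'(3) by simp
      then have "length l' = n - n div 2" using l'(4) by simp
      moreover have "balanced n 2 = {#n div 2, n - n div 2#}"
      proof (cases "n mod 2 = 0")
        case True
        then have "n - n div 2 = n div 2" by presburger
        then show ?thesis using True by (simp add: balanced_def numeral_2_eq_2)
      next
        case False
        then have "n mod 2 = 1" "n - n div 2 = Suc (n div 2)" by presburger+
        then show ?thesis by (simp add: balanced_def)
      qed
      moreover have "mset (concat (rev (xs' @ [v']) # [l'])) = mset (xs' @ v' # l')" by simp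
      moreover have "mset (concat (rev (xs @ [v]) # [l])) = mset (xs @ v # l)" by simp
      ultimately show ?thesis
        using l' l b(3) True by (intro exI[of _ xs'] exI[of _ v'] exI[of _ "[l']"]) (auto simp del: concat.simps)
    qed
    then obtain xs' v' ls' where b': "broom xs' v' ls' = broom xs v ls" "[] \<notin> set ls'"
      "mset (concat (rev (xs' @ [v']) # ls')) = mset_set (pverts H)"
      "mset (Suc (length xs') # map length ls') = balanced n k" by blast
    \<comment> \<open>The paths are sorted by length to match the order of the list \<open>ns\<close>.\<close>
    define L where "L = sort_key length (rev (xs' @ [v']) # ls')"
    have setL: "set L = set (rev (xs' @ [v']) # ls')" by (simp only: L_def set_sort)
    have "mset L = mset (rev (xs' @ [v']) # ls')" by (simp only: L_def mset_sort)
    moreover have "mset (concat K) = (\<Sum>l\<in>#mset K. mset l)" for K :: "'a list list"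
      by (metis mset_concat mset_map sum_mset_sum_list)
    ultimately have concL: "mset (concat L) = mset_set (pverts H)" using b'(3) by metis
    have "mset (map length L) = mset (map length (rev (xs' @ [v']) # ls'))"
      unfolding mset_map \<open>mset L = _\<close> ..
    then have "mset (map length L) = mset ns" using b'(4) by (simp add: ns)
    moreover have "sorted (map length L)" by (simp only: L_def sorted_sort_key)
    moreover have "sorted ns" by (auto simp: ns_def sorted_append)
    ultimately have mapL: "map length L = ns" by (metis properties_for_sort)
    have conn: "conn (parcs H) S" if "S \<in> regions (broom xs' v' ls')" for S
      using that F b'(1) by auto
    have "digraph_iso (with_proj H) (with_proj (clique_paths (map length L)))"
    proof (rule iso_clique_pathsI[OF H(1) _ concL])
      show "[] \<notin> set L" using b'(2) setL by auto
      show "conn (parcs H) {l ! i, l ! Suc i}" if "l \<in> set L" "Suc i < length l" for l i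
        using conn broom_path_region[OF b'(2)] that setL by simp
      show "conn (parcs H) {hd l, hd l'}" if "l \<in> set L" "l' \<in> set L" "hd l \<noteq> hd l'" for l l'
        using conn broom_hub_region[OF b'(2)] that setL by simp
      show "?N \<le> clique_paths_count (mset (map length L))" using N mapL by simp
    qed
    then show ?thesis by (simp only: mapL)
  qed
  moreover have "?N = clique_paths_count (mset ns)" if iso: "digraph_iso (with_proj H) (with_proj (clique_paths ns))"
  proof -
    have pos: "\<forall>m\<in>set ns. m \<ge> 1" using s by (auto simp: ns_def)
    show ?thesis
      using num_conn_clique_paths_ge[OF pos] num_conn_digraph_iso[OF H(1) pair_graph_clique_paths[OF pos] iso] bound
      by simp
  qed
  ultimately show ?thesis using bound by blast
qed

theorem theorem11:
  fixes n c s t :: nat and H :: "'a pair_pre_digraph"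
  assumes "n > 1" and "c \<le> n - 2"
    and "t = n mod (n - c)" and "s = n div (n - c)"
    and "pair_graph H" and "connected (with_proj H)"
    and "card (pverts H) = n" and "card {u. cut_vertex (with_proj H) u} = c"
  shows "num_conn_induced (with_proj H)
           \<le> (n - c - t) * (s choose 2) + t * ((s + 1) choose 2)
             + (s + 1) ^ (n - c - t) * (s + 2) ^ t - 1
       \<and> (num_conn_induced (with_proj H)
           = (n - c - t) * (s choose 2) + t * ((s + 1) choose 2)
             + (s + 1) ^ (n - c - t) * (s + 2) ^ t - 1
         \<longleftrightarrow> digraph_iso (with_proj H)
               (with_proj (clique_paths (replicate (n - c - t) s @ replicate t (s + 1)))))"
proof -
  interpret pair_graph H by fact
  let ?E = "parcs H" and ?V = "pverts H"
  have cut: "{u. cut_vertex (with_proj H) u} = ?V - {v \<in> ?V. conn ?E (?V - {v})}"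
    using cut_vertex_iff_conn[OF assms(5,6)] assms(1,7) by auto
  have "card {v \<in> ?V. conn ?E (?V - {v})} = n - c"
    using assms(7,8) card_mono[OF pair_finite_verts, of "{v \<in> ?V. conn ?E (?V - {v})}"] pair_finite_verts
    unfolding cut by (subst (asm) card_Diff_subset) auto
  moreover have "n - c \<ge> 2" using assms(1,2) by simp
  moreover have "conn ?E ?V" using assms(5,6) connected_iff_conn by blast
  ultimately have "num_conn ?E ?V \<le> clique_paths_count (mset (replicate (n - c - t) s @ replicate t (s + 1))) \<and>
    (num_conn ?E ?V = clique_paths_count (mset (replicate (n - c - t) s @ replicate t (s + 1))) \<longleftrightarrow>
      digraph_iso (with_proj H) (with_proj (clique_paths (replicate (n - c - t) s @ replicate t (s + 1)))))"
    unfolding assms(3,4) using connected_induced_bound[OF assms(5) _ assms(7)] by blast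
  moreover have "clique_paths_count (mset (replicate (n - c - t) s @ replicate t (s + 1)))
    = (n - c - t) * (s choose 2) + t * ((s + 1) choose 2) + (s + 1) ^ (n - c - t) * (s + 2) ^ t - 1"
    using clique_paths_count_balanced[of n "n - c"] unfolding assms(3,4) balanced_def by simp
  ultimately show ?thesis unfolding num_conn_induced_eq_num_conn[OF assms(5)] by simp
qed

end
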